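(* There exists a randomized polynomial time algorithm which takes as input a normalized monotone (non-decreasing) supermodular function $f:2^V\rightarrow\mathbb{Z}$ (given by evaluation oracle access), element deletion costs $c:V\rightarrow\mathbb{R}_{\ge 0}$, a target density $\rho\in \mathbb{R}$, and an error parameter $\epsilon \in (0, 1)$, and returns a set $S\subseteq V$ such that: (1) $\lambda^*_{f|_{V - S}} \leq c_f(1+\epsilon)\cdot \rho$, and (2) $\mathbb{E}\left[\sum_{u\in S}c_u\right] \leq c_f \left(1+\frac{1}{\epsilon}\right)\cdot \mathrm{OPT}$, where $\mathrm{OPT}$ denotes the cost of an optimum solution to $\rho$-SupmodDD on the instance $(f,c)$.
   Context: A set function $f:2^V\to\mathbb{R}$ on a finite set $V$ is supermodular if $f(A)+f(B)\le f(A\cap B)+f(A\cup B)$ for all $A,B\subseteq V$, non-decreasing (monotone) if $f(A)\le f(B)$ whenever $A\subseteq B$, and normalized if $f(\emptyset)=0$. The marginal is $f(v\,|\,S):=f(S\cup\{v\})-f(S)$. The density is $\lambda^*_f:=\max\{f(S)/|S|:\emptyset\neq S\subseteq V\}$ (for an empty ground set any condition $\lambda^*_f\le\rho$ is considered to hold), and $f|_{V-S}$ is the restriction of $f$ to subsets of $V\setminus S$. The problem $\rho$-SupmodDD on an instance $(f,c)$ is to find $S\subseteq V$ minimizing $\sum_{u\in S}c_u$ subject to $\lambda^*_{f|_{V-S}}\le\rho$. The parameter $c_f$ is $$c_f := \max\left\{\frac{\sum_{u \in S}f(u\,|\,S-u)}{f(S)}: S\subseteq V\right\},\qquad S-u:=S\setminus\{u\},$$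 where the maximum is over sets $S$ with $f(S)>0$ (and $c_f:=1$ if there is no such set). *)

theory Defs
  imports "HOL-Probability.Probability_Mass_Function" "HOL-Computational_Algebra.Polynomial"
begin

section \<open>Supermodular functions and density deletion\<close>

text \<open>Set functions are total on \<open>'a set\<close>; only their values on subsets of the ground set
  \<open>V\<close> matter. In particular the restriction of \<open>f\<close> to the subsets of
  \<open>V - S\<close> is \<open>f\<close> considered on the ground set \<open>V - S\<close>.\<close>

definition supermodular_on :: "'a set \<Rightarrow> ('a set \<Rightarrow> int) \<Rightarrow> bool" where
  "supermodular_on V f \<longleftrightarrow>
     (\<forall>A B. A \<subseteq> V \<and> B \<subseteq> V \<longrightarrow> f A + f B \<le> f (A \<inter> B) + f (A \<union> B))"

definition nondecreasing_on :: "'a set \<Rightarrow> ('a set \<Rightarrow> int) \<Rightarrow> bool" where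
  "nondecreasing_on V f \<longleftrightarrow> (\<forall>A B. A \<subseteq> B \<and> B \<subseteq> V \<longrightarrow> f A \<le> f B)"

definition normalized_fun :: "('a set \<Rightarrow> int) \<Rightarrow> bool" where
  "normalized_fun f \<longleftrightarrow> f {} = 0"

definition marginal :: "('a set \<Rightarrow> int) \<Rightarrow> 'a \<Rightarrow> 'a set \<Rightarrow> int" where
  "marginal f v S = f (S \<union> {v}) - f S"

text \<open>Meaningful for finite nonempty \<open>V\<close> only (otherwise \<open>Max\<close> is unspecified);
  \<open>max_density_le\<close> adds the convention for the empty ground set.\<close>

definition max_density :: "'a set \<Rightarrow> ('a set \<Rightarrow> int) \<Rightarrow> real" where
  "max_density V f = Max {real_of_int (f S) / real (card S) | S. S \<noteq> {} \<and> S \<subseteq> V}"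

definition max_density_le :: "'a set \<Rightarrow> ('a set \<Rightarrow> int) \<Rightarrow> real \<Rightarrow> bool" where
  "max_density_le V f \<rho> \<longleftrightarrow> V = {} \<or> max_density V f \<le> \<rho>"

definition c_param :: "'a set \<Rightarrow> ('a set \<Rightarrow> int) \<Rightarrow> real" where
  "c_param V f =
     (if \<exists>S\<subseteq>V. f S > 0
      then Max {real_of_int (\<Sum>u\<in>S. marginal f u (S - {u})) / real_of_int (f S) | S.
                S \<subseteq> V \<and> f S > 0}
      else 1)"

text \<open>The minimum is over a finite set, nonempty because \<open>S = V\<close> is always feasible.\<close>

definition supmod_dd_opt :: "'a set \<Rightarrow> ('a set \<Rightarrow> int) \<Rightarrow> ('a \<Rightarrow> real) \<Rightarrow> real \<Rightarrow> real" where
  "supmod_dd_opt V f c \<rho> = Min {(\<Sum>u\<in>S. c u) | S. S \<subseteq> V \<and> max_density_le (V - S) f \<rho>}"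


section \<open>Randomized real-RAM programs with a value oracle\<close>

text \<open>
  Since costs, target density and error parameter are real numbers, algorithms are programs for a
  unit-cost real RAM. The memory consists of natural-number arrays and real arrays (a scalar is
  cell 0 of an array). Available are addition and truncated subtraction on naturals, exact field
  arithmetic and comparison on reals, and the embedding of naturals into reals, but no rounding
  from reals to naturals. Program constants are integers, so that no non-uniform information can
  be hidden in a program. Every small step costs one time unit; as the expressions of a fixed
  program have bounded size, this is the usual count of elementary operations up to a constant
  factor.\<close>

type_synonym vname = string

datatype nexp =
    NConst nat
  | NCell vname nexp
  | NAdd nexp nexp
  | NSub nexp nexp

datatype rexp =
    RConst int
  | RNat nexp
  | RCell vname nexp
  | RAdd rexp rexp
  | RSub rexp rexp
  | RMul rexp rexp
  | RDiv rexp rexp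

datatype bexp =
    NLess nexp nexp
  | RLess rexp rexp
  | BNot bexp
  | BAnd bexp bexp

text \<open>\<open>Query q x i\<close> stores in real cell \<open>x[i]\<close> the oracle value of the set whose
  characteristic vector is the array \<open>q\<close>. \<open>Flip x i r\<close> tosses a coin with bias
  \<open>r\<close> and stores the outcome, 0 or 1, in natural cell \<open>x[i]\<close>; tosses of this
  kind allow exact sampling from a finite set with computed real weights.\<close>

datatype com =
    Skip
  | AssignN vname nexp nexp
  | AssignR vname nexp rexp
  | Query vname vname nexp
  | Flip vname nexp rexp
  | Seq com com
  | If bexp com com
  | While bexp com

datatype state = State (nmem: "vname \<Rightarrow> nat \<Rightarrow> nat") (rmem: "vname \<Rightarrow> nat \<Rightarrow> real")

definition write_nat :: "vname \<Rightarrow> nat \<Rightarrow> nat \<Rightarrow> state \<Rightarrow> state" where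
  "write_nat x i v s = State ((nmem s)(x := (nmem s x)(i := v))) (rmem s)"

definition write_real :: "vname \<Rightarrow> nat \<Rightarrow> real \<Rightarrow> state \<Rightarrow> state" where
  "write_real x i v s = State (nmem s) ((rmem s)(x := (rmem s x)(i := v)))"

primrec nval :: "nexp \<Rightarrow> state \<Rightarrow> nat" where
  "nval (NConst k) s = k"
| "nval (NCell x i) s = nmem s x (nval i s)"
| "nval (NAdd a b) s = nval a s + nval b s"
| "nval (NSub a b) s = nval a s - nval b s"

primrec rval :: "rexp \<Rightarrow> state \<Rightarrow> real" where
  "rval (RConst k) s = real_of_int k"
| "rval (RNat a) s = real (nval a s)"
| "rval (RCell x i) s = rmem s x (nval i s)"
| "rval (RAdd a b) s = rval a s + rval b s"
| "rval (RSub a b) s = rval a s - rval b s"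
| "rval (RMul a b) s = rval a s * rval b s"
| "rval (RDiv a b) s = rval a s / rval b s"

primrec bval :: "bexp \<Rightarrow> state \<Rightarrow> bool" where
  "bval (NLess a b) s \<longleftrightarrow> nval a s < nval b s"
| "bval (RLess a b) s \<longleftrightarrow> rval a s < rval b s"
| "bval (BNot b) s \<longleftrightarrow> \<not> bval b s"
| "bval (BAnd a b) s \<longleftrightarrow> bval a s \<and> bval b s"

text \<open>One step of computation, as a distribution on successor configurations. The terminal
  command \<open>Skip\<close> is absorbing. Note that \<open>bernoulli_pmf\<close> truncates its parameter
  to the unit interval.\<close>

primrec step :: "(nat set \<Rightarrow> int) \<Rightarrow> com \<Rightarrow> state \<Rightarrow> (com \<times> state) pmf" where
  "step orc Skip s = return_pmf (Skip, s)"
| "step orc (AssignN x i a) s = return_pmf (Skip, write_nat x (nval i s) (nval a s) s)"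
| "step orc (AssignR x i a) s = return_pmf (Skip, write_real x (nval i s) (rval a s) s)"
| "step orc (Query q x i) s =
     return_pmf (Skip, write_real x (nval i s) (real_of_int (orc {j. nmem s q j \<noteq> 0})) s)"
| "step orc (Flip x i r) s =
     map_pmf (\<lambda>b. (Skip, write_nat x (nval i s) (of_bool b) s)) (bernoulli_pmf (rval r s))"
| "step orc (Seq P Q) s =
     (if P = Skip then return_pmf (Q, s)
      else map_pmf (\<lambda>(P', s'). (Seq P' Q, s')) (step orc P s))"
| "step orc (If b P Q) s = return_pmf (if bval b s then P else Q, s)"
| "step orc (While b P) s = return_pmf (If b (Seq P (While b P)) Skip, s)"

primrec run :: "(nat set \<Rightarrow> int) \<Rightarrow> nat \<Rightarrow> com \<times> state \<Rightarrow> (com \<times> state) pmf" where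
  "run orc 0 cfg = return_pmf cfg"
| "run orc (Suc t) cfg = bind_pmf (run orc t cfg) (\<lambda>(P, s). step orc P s)"


section \<open>Algorithms for instances of density deletion\<close>

text \<open>The ground set is presented as a list \<open>vs\<close> without repetitions, and the machine
  refers to the elements by their positions in the list. The values of \<open>f\<close> are accessible
  through the oracle only; a query ignores positions outside the list.\<close>

definition indexed_subset :: "'a list \<Rightarrow> nat set \<Rightarrow> 'a set" where
  "indexed_subset vs I = {vs ! i | i. i < length vs \<and> i \<in> I}"

definition value_oracle :: "'a list \<Rightarrow> ('a set \<Rightarrow> int) \<Rightarrow> nat set \<Rightarrow> int" where
  "value_oracle vs f I = f (indexed_subset vs I)"

definition input_state :: "'a list \<Rightarrow> ('a \<Rightarrow> real) \<Rightarrow> real \<Rightarrow> real \<Rightarrow> state" where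
  "input_state vs c \<rho> \<epsilon> =
     State
       (\<lambda>x i. if x = ''n'' \<and> i = 0 then length vs else 0)
       (\<lambda>x i. if x = ''cost'' \<and> i < length vs then c (vs ! i)
              else if x = ''rho'' \<and> i = 0 then \<rho>
              else if x = ''eps'' \<and> i = 0 then \<epsilon>
              else 0)"

definition output_set :: "'a list \<Rightarrow> state \<Rightarrow> 'a set" where
  "output_set vs s = indexed_subset vs {i. nmem s ''out'' i \<noteq> 0}"

definition run_instance ::
  "com \<Rightarrow> 'a list \<Rightarrow> ('a set \<Rightarrow> int) \<Rightarrow> ('a \<Rightarrow> real) \<Rightarrow> real \<Rightarrow> real \<Rightarrow> nat \<Rightarrow> (com \<times> state) pmf" where
  "run_instance P vs f c \<rho> \<epsilon> t = run (value_oracle vs f) t (P, input_state vs c \<rho> \<epsilon>)"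

text \<open>Termination within \<open>t\<close> steps for every outcome of the coin tosses.\<close>

definition halts_within ::
  "com \<Rightarrow> 'a list \<Rightarrow> ('a set \<Rightarrow> int) \<Rightarrow> ('a \<Rightarrow> real) \<Rightarrow> real \<Rightarrow> real \<Rightarrow> nat \<Rightarrow> bool" where
  "halts_within P vs f c \<rho> \<epsilon> t \<longleftrightarrow>
     (\<forall>(Q, s) \<in> set_pmf (run_instance P vs f c \<rho> \<epsilon> t). Q = Skip)"

text \<open>The distribution of the returned set, given that the program halts within \<open>t\<close>
  steps (it then does not depend on \<open>t\<close>). Its support is finite.\<close>

definition returned_set ::
  "com \<Rightarrow> 'a list \<Rightarrow> ('a set \<Rightarrow> int) \<Rightarrow> ('a \<Rightarrow> real) \<Rightarrow> real \<Rightarrow> real \<Rightarrow> nat \<Rightarrow> 'a set pmf" where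
  "returned_set P vs f c \<rho> \<epsilon> t =
     map_pmf (\<lambda>(Q, s). output_set vs s) (run_instance P vs f c \<rho> \<epsilon> t)"

end

theory Submission
  imports Defs
begin

text \<open>A deterministic local-ratio algorithm suffices. Keep a set \<open>U\<close> of undecided
  elements, residual costs \<open>c'\<close>, and put \<open>w u = f(u | U - u)\<close>. If
  \<open>f(U) > (1 + \<epsilon>) \<rho> |U|\<close>, subtract from \<open>c'\<close> the largest multiple of \<open>w\<close> that keeps it
  nonnegative and delete an element of residual cost \<open>0\<close>. Otherwise discard from \<open>U\<close>, without
  deleting it, an element minimizing \<open>w\<close>. After \<open>|V|\<close> rounds \<open>U\<close> is empty.

  Cost: if \<open>\<rho> < 0\<close>, only \<open>J = V\<close> is feasible. Otherwise
  \<open>w(U) \<le> c\<^sub>f f(U)\<close>, while a feasible solution \<open>J\<close> satisfies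
  \<open>w(J \<inter> U) \<ge> f(U) - f(U - J) \<ge> f(U) - \<rho> |U| > \<epsilon> / (1 + \<epsilon>) f(U)\<close>; hence each subtraction
  decreases the total cost by at most \<open>c\<^sub>f (1 + 1/\<epsilon>)\<close> times the decrease of the cost of \<open>J\<close>.

  Density: when \<open>b\<close> is discarded, \<open>w b\<close> is at most the average
  \<open>w(U) / |U| \<le> c\<^sub>f (1 + \<epsilon>) \<rho>\<close>. By supermodularity every surviving set \<open>A\<close> has an element of
  marginal at most \<open>c\<^sub>f (1 + \<epsilon>) \<rho>\<close> in \<open>A\<close>, namely the one discarded first, and induction on
  \<open>A\<close> bounds its density.\<close>

section \<open>Supermodular functions\<close>

text \<open>Supermodularity for the pair \<open>A\<close>, \<open>B - {b}\<close>, whose meet is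
  \<open>A - {b}\<close> and whose join is \<open>B\<close>.\<close>

lemma marginal_mono:
  assumes "supermodular_on V f" "A \<subseteq> B" "B \<subseteq> V" "b \<in> A"
  shows "f A - f (A - {b}) \<le> f B - f (B - {b})"
proof -
  have "A \<inter> (B - {b}) = A - {b}" "A \<union> (B - {b}) = B" using assms by auto
  moreover have "A \<subseteq> V" "B - {b} \<subseteq> V" using assms by auto
  ultimately show ?thesis
    using assms(1) unfolding supermodular_on_def by (smt (verit))
qed

text \<open>Removing \<open>X\<close> from \<open>U\<close> one element at a time telescopes the
  left side; each drop is a marginal in a subset of \<open>U\<close>, so
  \<open>marginal_mono\<close> applies.\<close>

lemma sum_marginals_ge:
  assumes "supermodular_on V f" "finite X" "X \<subseteq> U" "U \<subseteq> V"
  shows "f U - f (U - X) \<le> (\<Sum>u\<in>X. f U - f (U - {u}))"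
  using assms(2,3)
proof (induction X rule: finite_induct)
  case (insert x X)
  have "f (U - X) - f (U - X - {x}) \<le> f U - f (U - {x})"
    using insert assms by (intro marginal_mono) auto
  moreover have "U - X - {x} = U - insert x X" by auto
  ultimately show ?case using insert by simp
qed simp

lemma nonneg_fun:
  assumes "normalized_fun f" "nondecreasing_on V f" "A \<subseteq> V"
  shows "0 \<le> f A"
  using assms unfolding normalized_fun_def nondecreasing_on_def by (metis empty_subsetI)

text \<open>Clearing \<open>Max\<close> and the denominators also absorbs the empty ground set, for
  which the right side is vacuous.\<close>

lemma max_density_le_iff:
  assumes "finite W"
  shows "max_density_le W f r \<longleftrightarrow>
    (\<forall>A. A \<subseteq> W \<and> A \<noteq> {} \<longrightarrow> real_of_int (f A) \<le> r * real (card A))"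
proof (cases "W = {}")
  case True
  then show ?thesis by (auto simp: max_density_le_def)
next
  case False
  let ?X = "{real_of_int (f S) / real (card S) | S. S \<noteq> {} \<and> S \<subseteq> W}"
  have "?X = (\<lambda>S. real_of_int (f S) / real (card S)) ` {S. S \<noteq> {} \<and> S \<subseteq> W}" by auto
  then have "finite ?X" using assms by simp
  moreover have "?X \<noteq> {}" using False by auto
  ultimately have "Max ?X \<le> r \<longleftrightarrow> (\<forall>x\<in>?X. x \<le> r)" by simp
  also have "\<dots> \<longleftrightarrow> (\<forall>A. A \<subseteq> W \<and> A \<noteq> {} \<longrightarrow> real_of_int (f A) / real (card A) \<le> r)" by blast
  also have "\<dots> \<longleftrightarrow> (\<forall>A. A \<subseteq> W \<and> A \<noteq> {} \<longrightarrow> real_of_int (f A) \<le> r * real (card A))"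
  proof -
    have "real_of_int (f A) / real (card A) \<le> r \<longleftrightarrow> real_of_int (f A) \<le> r * real (card A)"
      if "A \<subseteq> W" "A \<noteq> {}" for A
    proof -
      have "0 < card A" using that assms by (simp add: card_gt_0_iff finite_subset)
      then show ?thesis by (simp add: divide_le_eq)
    qed
    then show ?thesis by blast
  qed
  finally show ?thesis using False by (simp add: max_density_le_def max_density_def)
qed

section \<open>Inequalities for the parameter \<open>c_param\<close>\<close>

lemma c_param_ratios_finite:
  assumes "finite V"
  shows "finite {real_of_int (\<Sum>u\<in>S. marginal f u (S - {u})) / real_of_int (f S) | S.
                S \<subseteq> V \<and> f S > 0}" (is "finite ?X")
proof -
  have "?X \<subseteq> (\<lambda>S. real_of_int (\<Sum>u\<in>S. marginal f u (S - {u})) / real_of_int (f S)) ` Pow V"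
    by auto
  then show ?thesis using assms by (meson finite_Pow_iff finite_imageI finite_subset)
qed

lemma ratio_le_c_param:
  assumes "finite V" "S \<subseteq> V" "f S > 0"
  shows "real_of_int (\<Sum>u\<in>S. marginal f u (S - {u})) / real_of_int (f S) \<le> c_param V f"
proof -
  let ?X = "{real_of_int (\<Sum>u\<in>S. marginal f u (S - {u})) / real_of_int (f S) | S.
                S \<subseteq> V \<and> f S > 0}"
  have "\<exists>S\<subseteq>V. f S > 0" using assms by blast
  then have "c_param V f = Max ?X"
    unfolding c_param_def by (rule if_P)
  moreover have "real_of_int (\<Sum>u\<in>S. marginal f u (S - {u})) / real_of_int (f S) \<in> ?X"
    unfolding mem_Collect_eq using assms by (intro exI[of _ S] conjI refl)
  ultimately show ?thesis
    using Max_ge[OF c_param_ratios_finite[OF assms(1)]] by simp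
qed

lemma sum_marginal_eq: "(\<Sum>u\<in>S. marginal f u (S - {u})) = (\<Sum>u\<in>S. f S - f (S - {u}))"
  by (intro sum.cong) (auto simp: marginal_def insert_absorb)

text \<open>Multiplying out extends the defining ratio to sets with \<open>f S = 0\<close>, which
  the maximum skips: monotonicity then makes every marginal vanish.\<close>

lemma sum_marginals_le_c_param:
  assumes "finite V" "normalized_fun f" "nondecreasing_on V f" "S \<subseteq> V"
  shows "real_of_int (\<Sum>u\<in>S. f S - f (S - {u})) \<le> c_param V f * real_of_int (f S)"
proof (cases "f S > 0")
  case True
  then have "real_of_int (\<Sum>u\<in>S. marginal f u (S - {u})) / real_of_int (f S) \<le> c_param V f"
    using ratio_le_c_param assms by blast
  then show ?thesis using True by (simp add: divide_le_eq sum_marginal_eq)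
next
  case False
  have "f (S - {u}) = 0" for u
  proof -
    have "f (S - {u}) \<le> f S" using assms unfolding nondecreasing_on_def by blast
    moreover have "0 \<le> f (S - {u})" using assms by (intro nonneg_fun[of f V]) auto
    ultimately show ?thesis using False by simp
  qed
  moreover have "f S = 0" using False nonneg_fun[OF assms(2-4)] by simp
  ultimately show ?thesis by simp
qed

text \<open>\<open>sum_marginals_ge\<close> with \<open>X = U = S\<close> makes any defining ratio
  at least \<open>1\<close>; the default value \<open>1\<close> handles the absence of
  ratios.\<close>

lemma c_param_ge_1:
  assumes "finite V" "normalized_fun f" "supermodular_on V f"
  shows "1 \<le> c_param V f"
proof (cases "\<exists>S\<subseteq>V. f S > 0")
  case True
  then obtain S where S: "S \<subseteq> V" "f S > 0" by blast
  have "f S - f (S - S) \<le> (\<Sum>u\<in>S. f S - f (S - {u}))"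
    using S assms by (intro sum_marginals_ge) (auto intro: finite_subset)
  then have "f S \<le> (\<Sum>u\<in>S. marginal f u (S - {u}))"
    using assms(2) by (simp add: normalized_fun_def sum_marginal_eq)
  then have "1 \<le> real_of_int (\<Sum>u\<in>S. marginal f u (S - {u})) / real_of_int (f S)"
    using S(2) by (simp add: le_divide_eq del: of_int_sum)
  also have "\<dots> \<le> c_param V f"
    using ratio_le_c_param assms S by blast
  finally show ?thesis .
next
  case False
  then have "c_param V f = 1" unfolding c_param_def by (rule if_not_P)
  then show ?thesis by simp
qed

text \<open>An empty ground set meets every density bound, so \<open>V\<close> itself is a candidate
  and the minimum is over a finite nonempty set.\<close>

lemma supmod_dd_opt_attained:
  assumes "finite V"
  obtains J where "J \<subseteq> V" "max_density_le (V - J) f \<rho>" "supmod_dd_opt V f c \<rho> = (\<Sum>u\<in>J. c u)"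
proof -
  let ?X = "{(\<Sum>u\<in>S. c u) | S. S \<subseteq> V \<and> max_density_le (V - S) f \<rho>}"
  have "?X \<subseteq> sum c ` Pow V" by auto
  then have "finite ?X" using assms by (meson finite_Pow_iff finite_imageI finite_subset)
  moreover have "max_density_le (V - V) f \<rho>" by (simp add: max_density_le_def)
  then have "?X \<noteq> {}" by blast
  ultimately have "Min ?X \<in> ?X" by (rule Min_in)
  then show ?thesis using that unfolding supmod_dd_opt_def by blast
qed


section \<open>The local-ratio algorithm\<close>

text \<open>\<open>C\<close> stands for \<open>c_f\<close> through the properties
  \<open>C_ge_1\<close> and \<open>C_bound\<close>. The ground set can then consist of positions
  while \<open>C\<close> still comes from the original instance.\<close>

locale local_ratio =
  fixes V :: "'b set" and f :: "'b set \<Rightarrow> int" and c :: "'b \<Rightarrow> real" and \<rho> \<epsilon> C :: real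
  assumes fin: "finite V" and norm: "normalized_fun f" and mono: "nondecreasing_on V f"
    and smod: "supermodular_on V f" and cost_nonneg: "\<And>u. u \<in> V \<Longrightarrow> 0 \<le> c u"
    and eps_pos: "0 < \<epsilon>" and C_ge_1: "1 \<le> C"
    and C_bound: "\<And>S. S \<subseteq> V \<Longrightarrow> real_of_int (\<Sum>u\<in>S. f S - f (S - {u})) \<le> C * real_of_int (f S)"
begin

text \<open>The value is \<open>0\<close> outside \<open>U\<close>, so weights can be summed over
  \<open>V\<close> or \<open>J\<close> without intersecting with \<open>U\<close>.\<close>

definition w :: "'b set \<Rightarrow> 'b \<Rightarrow> real" where
  "w U u = real_of_int (f U) - real_of_int (f (U - {u}))"

definition feasible :: "'b set \<Rightarrow> bool" where
  "feasible J \<longleftrightarrow> J \<subseteq> V \<and>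
     (\<forall>A. A \<subseteq> V - J \<and> A \<noteq> {} \<longrightarrow> real_of_int (f A) \<le> \<rho> * real (card A))"

text \<open>State after \<open>k\<close> rounds, with residual costs \<open>c'\<close>. The density
  clause concerns surviving sets containing an element that has left \<open>U\<close>, hence all
  nonempty ones once \<open>U\<close> is empty. The last clause compares the charges on
  \<open>V\<close> with those on any feasible \<open>J\<close>; it assumes
  \<open>0 \<le> \<rho>\<close> because a negative \<open>\<rho>\<close> forces
  \<open>J = V\<close>.\<close>

definition inv :: "nat \<Rightarrow> 'b set \<Rightarrow> 'b set \<Rightarrow> ('b \<Rightarrow> real) \<Rightarrow> bool" where
  "inv k U S c' \<longleftrightarrow> U \<subseteq> V \<and> S \<subseteq> V \<and> S \<inter> U = {} \<and> card U = card V - k \<and>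
     (\<forall>A. A \<noteq> {} \<and> A \<subseteq> V - S \<and> \<not> A \<subseteq> U \<longrightarrow> (\<exists>b\<in>A. w A b \<le> C * (1 + \<epsilon>) * \<rho>)) \<and>
     (\<forall>u\<in>V. 0 \<le> c' u \<and> c' u \<le> c u) \<and>
     (0 \<le> \<rho> \<longrightarrow> (\<forall>u\<in>S. c' u = 0) \<and>
        (\<forall>J. feasible J \<longrightarrow>
          (\<Sum>u\<in>V. c u - c' u) \<le> C * (1 + 1 / \<epsilon>) * (\<Sum>u\<in>J. c u - c' u)))"

lemma w_nonneg: "U \<subseteq> V \<Longrightarrow> 0 \<le> w U u"
  using mono unfolding w_def nondecreasing_on_def by (auto simp: subset_iff)

lemma f_nonneg: "U \<subseteq> V \<Longrightarrow> 0 \<le> f U"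
  using nonneg_fun[OF norm mono] .

lemma w_outside: "u \<notin> U \<Longrightarrow> w U u = 0"
  by (simp add: w_def)

lemma w_mono: "A \<subseteq> B \<Longrightarrow> B \<subseteq> V \<Longrightarrow> b \<in> A \<Longrightarrow> w A b \<le> w B b"
  using marginal_mono[OF smod, of A B b] unfolding w_def by linarith

lemma sum_w_le: "U \<subseteq> V \<Longrightarrow> (\<Sum>u\<in>U. w U u) \<le> C * real_of_int (f U)"
  using C_bound[of U] by (simp add: w_def)

lemma sum_w_ge: "U \<subseteq> V \<Longrightarrow> X \<subseteq> U \<Longrightarrow> real_of_int (f U) - real_of_int (f (U - X)) \<le> (\<Sum>u\<in>X. w U u)"
  using sum_marginals_ge[OF smod, of X U] fin
  by (simp add: w_def finite_subset flip: of_int_diff of_int_sum of_int_le_iff)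

section \<open>Establishing and preserving the invariant\<close>

lemma inv_init:
  assumes "\<And>u. u \<in> V \<Longrightarrow> c' u = c u"
  shows "inv 0 V {} c'"
proof -
  have "(\<Sum>u\<in>J. c u - c' u) = 0" if "J \<subseteq> V" for J
    using assms that by (intro sum.neutral) auto
  then show ?thesis using assms cost_nonneg by (auto simp: inv_def feasible_def)
qed

text \<open>Since \<open>U\<close> is dense and \<open>U - J\<close> is sparse, the marginals in
  \<open>J\<close> must account for a fraction \<open>\<epsilon> / (1 + \<epsilon>)\<close> of
  \<open>f U\<close>, while \<open>C_bound\<close> caps the weight of all of
  \<open>U\<close>.\<close>

lemma sum_w_le_feasible:
  assumes "U \<subseteq> V" "feasible J" "0 \<le> \<rho>" and dense: "(1 + \<epsilon>) * \<rho> * real (card U) < real_of_int (f U)"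
  shows "(\<Sum>u\<in>V. w U u) \<le> C * (1 + 1 / \<epsilon>) * (\<Sum>u\<in>J. w U u)"
proof -
  have finU: "finite U" and finJ: "finite J"
    using assms fin by (auto simp: feasible_def intro: finite_subset)
  have "real_of_int (f (U - J)) \<le> \<rho> * real (card (U - J))"
  proof (cases "U - J = {}")
    \<comment> \<open>\<open>feasible\<close> speaks of nonempty sets, so an empty difference is
      split off.\<close>
    case True
    then show ?thesis using norm unfolding normalized_fun_def by (simp only:) simp
  next
    case False
    moreover have "U - J \<subseteq> V - J" using assms(1) by auto
    ultimately show ?thesis using assms(2) unfolding feasible_def by blast
  qed
  also have "\<dots> \<le> \<rho> * real (card U)"
    using finU assms(3) by (intro mult_left_mono) (auto intro: card_mono)
  finally have "(1 + \<epsilon>) * real_of_int (f (U - J)) \<le> (1 + \<epsilon>) * (\<rho> * real (card U))"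
    using eps_pos by (intro mult_left_mono) auto
  also have "\<dots> \<le> real_of_int (f U)" using dense by (simp add: mult.assoc)
  finally have "\<epsilon> * real_of_int (f U) \<le> (1 + \<epsilon>) * (real_of_int (f U) - real_of_int (f (U - J)))"
    by (simp add: algebra_simps)
  also have "\<dots> \<le> (1 + \<epsilon>) * (\<Sum>u\<in>J \<inter> U. w U u)"
    using sum_w_ge[OF assms(1), of "J \<inter> U"] eps_pos
    by (intro mult_left_mono) (auto simp: Diff_Int)
  also have "(\<Sum>u\<in>J \<inter> U. w U u) = (\<Sum>u\<in>J. w U u)"
    using finJ by (intro sum.mono_neutral_left) (auto simp: w_outside)
  finally have 1: "real_of_int (f U) \<le> (1 + 1 / \<epsilon>) * (\<Sum>u\<in>J. w U u)"
    using eps_pos by (simp add: field_simps)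
  have "(\<Sum>u\<in>V. w U u) = (\<Sum>u\<in>U. w U u)"
    using fin assms(1) by (intro sum.mono_neutral_right) (auto simp: w_outside)
  also have "\<dots> \<le> C * real_of_int (f U)" by (rule sum_w_le[OF assms(1)])
  also have "\<dots> \<le> C * ((1 + 1 / \<epsilon>) * (\<Sum>u\<in>J. w U u))"
    using 1 C_ge_1 by (intro mult_left_mono) auto
  finally show ?thesis by (simp add: mult.assoc)
qed

text \<open>With \<open>c' b / w U b\<close> the least ratio of residual cost to weight, the
  subtraction keeps costs nonnegative and makes \<open>b\<close> free; the charges grow by a
  multiple of the inequality \<open>sum_w_le_feasible\<close>. The cross-multiplied form of
  \<open>best\<close> still makes sense when \<open>w U b = 0\<close>.\<close>

lemma inv_delete:
  assumes inv: "inv k U S c'" and b: "b \<in> U"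
    and dense: "(1 + \<epsilon>) * \<rho> * real (card U) < real_of_int (f U)"
    and best: "\<And>u. u \<in> U \<Longrightarrow> c' b * w U u \<le> c' u * w U b"
    and c'': "\<And>u. u \<in> V \<Longrightarrow> c'' u = c' u - c' b / w U b * w U u"
  shows "inv (Suc k) (U - {b}) (insert b S) c''"
proof -
  have UV: "U \<subseteq> V" and SV: "S \<subseteq> V" "S \<inter> U = {}" and card: "card U = card V - k"
    and dens: "\<And>A. A \<noteq> {} \<Longrightarrow> A \<subseteq> V - S \<Longrightarrow> \<not> A \<subseteq> U \<Longrightarrow> (\<exists>b\<in>A. w A b \<le> C * (1 + \<epsilon>) * \<rho>)"
    using inv unfolding inv_def by auto
  have "card (U - {b}) = card V - Suc k" using b card by simp
  moreover
  have c'V: "\<And>u. u \<in> V \<Longrightarrow> 0 \<le> c' u \<and> c' u \<le> c u"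
    using inv unfolding inv_def by auto
  define \<delta> where "\<delta> = c' b / w U b"
  have bV: "b \<in> V" using b UV by auto
  have w0: "0 \<le> w U u" for u using w_nonneg[OF UV] .
  have \<delta>0: "0 \<le> \<delta>" using w0 c'V[OF bV] by (simp add: \<delta>_def)
  have \<delta>_le: "\<delta> * w U u \<le> c' u" if "u \<in> V" for u
  proof (cases "u \<in> U \<and> w U b > 0")
    case True
    then show ?thesis using best[of u] by (simp add: \<delta>_def divide_le_eq)
  next
    case False
    \<comment> \<open>Either \<open>u\<close> has weight \<open>0\<close>, or
      \<open>w U b = 0\<close> and then \<open>\<delta> = 0\<close>, as division by zero yields
      \<open>0\<close>.\<close>
    then have "\<delta> * w U u = 0" using w0[of b] by (auto simp: \<delta>_def w_outside)
    then show ?thesis using c'V[OF that] by linarith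
  qed
  have "\<forall>u\<in>V. 0 \<le> c'' u \<and> c'' u \<le> c u"
  proof
    fix u assume u: "u \<in> V"
    show "0 \<le> c'' u \<and> c'' u \<le> c u"
      using \<delta>_le[OF u] c'V[OF u] c''[OF u] mult_nonneg_nonneg[OF \<delta>0 w0[of u]]
      unfolding \<delta>_def by linarith
  qed
  moreover have "(\<forall>u\<in>insert b S. c'' u = 0) \<and>
        (\<forall>J. feasible J \<longrightarrow>
          (\<Sum>u\<in>V. c u - c'' u) \<le> C * (1 + 1 / \<epsilon>) * (\<Sum>u\<in>J. c u - c'' u))"
    if \<rho>: "0 \<le> \<rho>"
  proof -
    have c'S: "\<And>u. u \<in> S \<Longrightarrow> c' u = 0"
      and bal: "\<And>J. feasible J \<Longrightarrow>
          (\<Sum>u\<in>V. c u - c' u) \<le> C * (1 + 1 / \<epsilon>) * (\<Sum>u\<in>J. c u - c' u)"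
      using inv \<rho> unfolding inv_def by auto
    have c''b: "c'' b = 0"
    proof (cases "w U b = 0")
      \<comment> \<open>Nothing is subtracted here. Density gives some \<open>u\<close> of positive
        weight, and \<open>best\<close> at this \<open>u\<close> forces \<open>c' b = 0\<close>
        already.\<close>
      case True
      have "0 \<le> (1 + \<epsilon>) * \<rho> * real (card U)" using \<rho> eps_pos by simp
      then have "0 < real_of_int (f U) - real_of_int (f (U - U))"
        using dense norm by (simp add: normalized_fun_def)
      also have "\<dots> \<le> (\<Sum>u\<in>U. w U u)" by (rule sum_w_ge[OF UV]) simp
      finally obtain u where "u \<in> U" "0 < w U u"
        using sum_nonpos[of U "w U"] by (meson not_less)
      then have "c' b = 0" using best[of u] True c'V[OF bV]
        by (metis mult_le_0_iff mult_zero_right order_antisym not_le)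
      then show ?thesis using c''[OF bV] by simp
    qed (simp add: c''[OF bV])
    \<comment> \<open>Deleted elements lie outside \<open>U\<close>, so later charges leave them
      untouched.\<close>
    have c''S: "c'' u = 0" if "u \<in> S" for u
    proof -
      have "u \<notin> U" "u \<in> V" using that SV by auto
      then show ?thesis using c''[of u] c'S[OF that] by (simp add: w_outside)
    qed
    have "(\<Sum>u\<in>V. c u - c'' u) \<le> C * (1 + 1 / \<epsilon>) * (\<Sum>u\<in>J. c u - c'' u)"
      if J: "feasible J" for J
    proof -
      have split: "(\<Sum>u\<in>X. c u - c'' u) = (\<Sum>u\<in>X. c u - c' u) + \<delta> * (\<Sum>u\<in>X. w U u)"
        if "X \<subseteq> V" for X
      proof -
        have "(\<Sum>u\<in>X. c u - c'' u) = (\<Sum>u\<in>X. (c u - c' u) + \<delta> * w U u)"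
          using that c'' by (intro sum.cong) (auto simp: \<delta>_def)
        then show ?thesis by (simp add: sum.distrib sum_distrib_left)
      qed
      have "\<delta> * (\<Sum>u\<in>V. w U u) \<le> \<delta> * (C * (1 + 1 / \<epsilon>) * (\<Sum>u\<in>J. w U u))"
        using sum_w_le_feasible[OF UV J \<rho> dense] \<delta>0 by (intro mult_left_mono)
      then show ?thesis
        using bal[OF J] J unfolding feasible_def by (simp add: split algebra_simps)
    qed
    then show ?thesis using c''b c''S by auto
  qed
  \<comment> \<open>A surviving set avoids \<open>b\<close>, so it was not contained in
    \<open>U\<close> before the round either, and the old clause applies.\<close>
  moreover have "\<exists>b\<in>A. w A b \<le> C * (1 + \<epsilon>) * \<rho>"
    if "A \<noteq> {}" "A \<subseteq> V - insert b S" "\<not> A \<subseteq> U - {b}" for A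
    using that by (intro dens) auto
  ultimately show ?thesis unfolding inv_def using UV SV b by auto
qed

text \<open>The least marginal is at most the average, which sparsity and \<open>C_bound\<close>
  keep below \<open>C * (1 + \<epsilon>) * \<rho>\<close>. The newly covered sets are the subsets of
  \<open>U\<close> containing \<open>b\<close>, where \<open>w_mono\<close> transfers the
  bound.\<close>

lemma inv_peel:
  assumes inv: "inv k U S c'" and b: "b \<in> U"
    and sparse: "real_of_int (f U) \<le> (1 + \<epsilon>) * \<rho> * real (card U)"
    and best: "\<And>u. u \<in> U \<Longrightarrow> w U b \<le> w U u"
  shows "inv (Suc k) (U - {b}) S c'"
proof -
  have UV: "U \<subseteq> V" and card: "card U = card V - k"
    and dens: "\<And>A. A \<noteq> {} \<Longrightarrow> A \<subseteq> V - S \<Longrightarrow> \<not> A \<subseteq> U \<Longrightarrow> (\<exists>b\<in>A. w A b \<le> C * (1 + \<epsilon>) * \<rho>)"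
    using inv unfolding inv_def by auto
  have finU: "finite U" using UV fin by (rule finite_subset)
  have "real (card U) * w U b \<le> (\<Sum>u\<in>U. w U u)"
    using best by (intro sum_bounded_below)
  also have "\<dots> \<le> C * real_of_int (f U)" by (rule sum_w_le[OF UV])
  also have "\<dots> \<le> C * ((1 + \<epsilon>) * \<rho> * real (card U))"
    using sparse C_ge_1 by (intro mult_left_mono) auto
  finally have "real (card U) * w U b \<le> real (card U) * (C * (1 + \<epsilon>) * \<rho>)"
    by (simp add: algebra_simps)
  moreover have "0 < card U" using finU b by (auto simp: card_gt_0_iff)
  ultimately have wb: "w U b \<le> C * (1 + \<epsilon>) * \<rho>" by (simp del: mult_le_cancel_left add: mult_le_cancel_left_pos)
  have "\<exists>b\<in>A. w A b \<le> C * (1 + \<epsilon>) * \<rho>"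
    if A: "A \<noteq> {}" "A \<subseteq> V - S" "\<not> A \<subseteq> U - {b}" for A
  proof (cases "A \<subseteq> U")
    case True
    then have "b \<in> A" using A by auto
    then show ?thesis using w_mono[OF True UV, of b] wb by force
  next
    case False
    then show ?thesis using A dens by blast
  qed
  moreover have "card (U - {b}) = card V - Suc k" using b card by simp
  ultimately show ?thesis using inv b unfolding inv_def by auto
qed

text \<open>Greedy peeling: each removal of a suitable \<open>b\<close> lowers the value by at most
  \<open>r\<close>, down to the empty set of value \<open>0\<close>.\<close>

lemma density_bound:
  assumes "\<And>A. A \<noteq> {} \<Longrightarrow> A \<subseteq> W \<Longrightarrow> \<exists>b\<in>A. w A b \<le> r" "A \<subseteq> W" "finite A"
  shows "real_of_int (f A) \<le> r * real (card A)"
  using assms(3,2)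
proof (induction A rule: finite_psubset_induct)
  case (psubset A)
  show ?case
  proof (cases "A = {}")
    case True
    then show ?thesis using norm by (simp add: normalized_fun_def)
  next
    case False
    then obtain b where b: "b \<in> A" "w A b \<le> r" using assms(1) psubset by blast
    have "real_of_int (f (A - {b})) \<le> r * real (card (A - {b}))"
      using b psubset by (intro psubset.IH) auto
    moreover have "card A = Suc (card (A - {b}))"
      by (rule card.remove[OF psubset(1) b(1)])
    ultimately show ?thesis using b(2) unfolding w_def by (simp add: algebra_simps)
  qed
qed

text \<open>\<open>U\<close> is now empty, so the density clause feeds \<open>density_bound\<close>.
  For \<open>0 \<le> \<rho>\<close> the elements of \<open>S\<close> have residual cost
  \<open>0\<close>: their cost is fully charged, and the balance bounds all charges.\<close>

lemma inv_final:
  assumes inv: "inv (card V) U S c'"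
  shows "S \<subseteq> V"
    and "\<And>A. A \<subseteq> V - S \<Longrightarrow> real_of_int (f A) \<le> C * (1 + \<epsilon>) * \<rho> * real (card A)"
    and "\<And>J. feasible J \<Longrightarrow> (\<Sum>u\<in>S. c u) \<le> C * (1 + 1 / \<epsilon>) * (\<Sum>u\<in>J. c u)"
proof -
  show SV: "S \<subseteq> V" using inv by (simp add: inv_def)
  have "U = {}" using inv fin unfolding inv_def by (auto dest: finite_subset)
  then have "\<exists>b\<in>A. w A b \<le> C * (1 + \<epsilon>) * \<rho>" if "A \<noteq> {}" "A \<subseteq> V - S" for A
    using that inv unfolding inv_def by auto
  then show "real_of_int (f A) \<le> C * (1 + \<epsilon>) * \<rho> * real (card A)" if "A \<subseteq> V - S" for A
    using that fin by (intro density_bound[of "V - S"]) (auto intro: finite_subset)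
  fix J assume J: "feasible J"
  then have JV: "J \<subseteq> V" by (simp add: feasible_def)
  have \<alpha>: "1 \<le> C * (1 + 1 / \<epsilon>)"
    using C_ge_1 eps_pos mult_mono[of 1 C 1 "1 + 1 / \<epsilon>"] by simp
  show "(\<Sum>u\<in>S. c u) \<le> C * (1 + 1 / \<epsilon>) * (\<Sum>u\<in>J. c u)"
  proof (cases "0 \<le> \<rho>")
    case True
    then have c'V: "\<And>u. u \<in> V \<Longrightarrow> 0 \<le> c' u \<and> c' u \<le> c u" and c'S: "\<And>u. u \<in> S \<Longrightarrow> c' u = 0"
      and bal: "(\<Sum>u\<in>V. c u - c' u) \<le> C * (1 + 1 / \<epsilon>) * (\<Sum>u\<in>J. c u - c' u)"
      using inv J unfolding inv_def by auto
    have "(\<Sum>u\<in>S. c u) = (\<Sum>u\<in>S. c u - c' u)" using c'S by simp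
    also have "\<dots> \<le> (\<Sum>u\<in>V. c u - c' u)" using SV fin c'V by (intro sum_mono2) auto
    also have "\<dots> \<le> C * (1 + 1 / \<epsilon>) * (\<Sum>u\<in>J. c u - c' u)" by (rule bal)
    also have "\<dots> \<le> C * (1 + 1 / \<epsilon>) * (\<Sum>u\<in>J. c u)"
      using \<alpha> JV c'V by (intro mult_left_mono sum_mono) auto
    finally show ?thesis .
  next
    case False
    \<comment> \<open>A singleton outside \<open>J\<close> would have density at least
      \<open>0\<close>, above \<open>\<rho>\<close>.\<close>
    have "V - J = {}"
    proof (rule ccontr)
      assume "V - J \<noteq> {}"
      then obtain u where u: "u \<in> V - J" by auto
      then have "real_of_int (f {u}) \<le> \<rho> * real (card {u})"
        using J unfolding feasible_def by blast
      moreover have "0 \<le> f {u}" using u by (intro f_nonneg) auto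
      ultimately show False using False by simp
    qed
    then have "J = V" using JV by auto
    have "(\<Sum>u\<in>S. c u) \<le> (\<Sum>u\<in>V. c u)" using SV fin cost_nonneg by (intro sum_mono2) auto
    also have "\<dots> \<le> C * (1 + 1 / \<epsilon>) * (\<Sum>u\<in>V. c u)"
      using mult_right_mono[OF \<alpha>, of "\<Sum>u\<in>V. c u"] cost_nonneg by (simp add: sum_nonneg)
    finally show ?thesis using \<open>J = V\<close> by simp
  qed
qed

end


section \<open>Timed total correctness of coin-free programs\<close>

text \<open>\<open>Skip\<close> is excluded because it loops on itself and because
  \<open>Seq Skip Q\<close> steps differently; thus steps lift under \<open>Seq\<close>.\<close>

definition det_step :: "(nat set \<Rightarrow> int) \<Rightarrow> com \<times> state \<Rightarrow> com \<times> state \<Rightarrow> bool" where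
  "det_step orc x y \<longleftrightarrow> fst x \<noteq> Skip \<and> step orc (fst x) (snd x) = return_pmf y"

definition wp :: "(nat set \<Rightarrow> int) \<Rightarrow> com \<Rightarrow> nat \<Rightarrow> (state \<Rightarrow> bool) \<Rightarrow> state \<Rightarrow> bool" where
  "wp orc P t Q s \<longleftrightarrow> (\<exists>k s'. k \<le> t \<and> (det_step orc ^^ k) (P, s) (Skip, s') \<and> Q s')"

section \<open>Deterministic runs as point masses\<close>

lemma run_Skip: "run orc t (Skip, s) = return_pmf (Skip, s)"
  by (induction t) (simp_all add: bind_return_pmf)

lemma run_add: "run orc (m + n) x = bind_pmf (run orc m x) (run orc n)"
  by (induction n) (simp_all add: bind_return_pmf' bind_assoc_pmf)

lemma run_det_steps: "(det_step orc ^^ k) x y \<Longrightarrow> run orc k x = return_pmf y"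
proof (induction k arbitrary: y)
  case (Suc k)
  then obtain z where z: "(det_step orc ^^ k) x z" "det_step orc z y" by auto
  have "run orc k x = return_pmf z" using z(1) by (rule Suc.IH)
  moreover have "step orc (fst z) (snd z) = return_pmf y"
    using z(2) by (simp add: det_step_def)
  ultimately show ?case by (simp add: bind_return_pmf case_prod_beta)
qed simp

text \<open>\<open>Skip\<close> is absorbing, so a run that stops early can be padded to exactly
  \<open>t\<close> steps.\<close>

lemma wp_run:
  assumes "wp orc P t Q s"
  obtains s' where "run orc t (P, s) = return_pmf (Skip, s')" "Q s'"
proof -
  obtain k s' where k: "k \<le> t" "(det_step orc ^^ k) (P, s) (Skip, s')" "Q s'"
    using assms unfolding wp_def by blast
  have "run orc (k + (t - k)) (P, s) = return_pmf (Skip, s')"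
    by (simp add: run_add run_det_steps[OF k(2)] bind_return_pmf run_Skip)
  then show ?thesis using k that by simp
qed

section \<open>Rules of the timed calculus\<close>

lemma wp_mono: "wp orc P t Q s \<Longrightarrow> t \<le> t' \<Longrightarrow> (\<And>s'. Q s' \<Longrightarrow> Q' s') \<Longrightarrow> wp orc P t' Q' s"
  unfolding wp_def by (meson order_trans)

lemma wp_Skip: "Q s \<Longrightarrow> wp orc Skip 0 Q s"
  unfolding wp_def by auto

lemma wp_step:
  assumes "P \<noteq> Skip" "step orc P s = return_pmf (P', s')" "wp orc P' t Q s'"
  shows "wp orc P (Suc t) Q s"
proof -
  obtain k s'' where k: "k \<le> t" "(det_step orc ^^ k) (P', s') (Skip, s'')" "Q s''"
    using assms(3) unfolding wp_def by blast
  have "det_step orc (P, s) (P', s')" using assms by (simp add: det_step_def)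
  then have "(det_step orc ^^ Suc k) (P, s) (Skip, s'')"
    using k(2) by (rule relpowp_Suc_I2)
  then show ?thesis using k unfolding wp_def by (metis Suc_le_mono)
qed

lemma wp_AssignN:
  "Q (write_nat x (nval i s) (nval a s) s) \<Longrightarrow> wp orc (AssignN x i a) 1 Q s"
  by (simp add: wp_step[where P = "AssignN x i a", OF _ _ wp_Skip])

lemma wp_AssignR:
  "Q (write_real x (nval i s) (rval a s) s) \<Longrightarrow> wp orc (AssignR x i a) 1 Q s"
  by (simp add: wp_step[where P = "AssignR x i a", OF _ _ wp_Skip])

lemma wp_Query:
  "Q (write_real x (nval i s) (real_of_int (orc {j. nmem s q j \<noteq> 0})) s) \<Longrightarrow>
    wp orc (Query q x i) 1 Q s"
  by (simp add: wp_step[where P = "Query q x i", OF _ _ wp_Skip])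

lemma wp_If:
  assumes "wp orc (if bval b s then P else P') t Q s"
  shows "wp orc (If b P P') (Suc t) Q s"
  using assms by (intro wp_step) auto

lemma det_steps_Seq:
  "(det_step orc ^^ k) (P, s) (P', s') \<Longrightarrow> (det_step orc ^^ k) (Seq P Q, s) (Seq P' Q, s')"
proof (induction k arbitrary: P' s')
  case (Suc k)
  then obtain R r where R: "(det_step orc ^^ k) (P, s) (R, r)" "det_step orc (R, r) (P', s')" by auto
  then have "det_step orc (Seq R Q, r) (Seq P' Q, s')" by (simp add: det_step_def)
  then show ?case using Suc.IH[OF R(1)] by auto
qed simp

text \<open>The extra \<open>1\<close> pays for the step from \<open>Seq Skip P'\<close> to
  \<open>P'\<close>.\<close>

lemma wp_Seq:
  assumes "wp orc P t (wp orc P' t' Q) s"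
  shows "wp orc (Seq P P') (t + t' + 1) Q s"
proof -
  obtain k s' where k: "k \<le> t" "(det_step orc ^^ k) (P, s) (Skip, s')" "wp orc P' t' Q s'"
    using assms unfolding wp_def[of _ P] by blast
  have "wp orc (Seq Skip P') (Suc t') Q s'" using k(3) by (intro wp_step) auto
  then obtain k' s'' where k': "k' \<le> Suc t'" "(det_step orc ^^ k') (Seq Skip P', s') (Skip, s'')" "Q s''"
    unfolding wp_def by blast
  have "(det_step orc ^^ (k + k')) (Seq P P', s) (Skip, s'')"
    using det_steps_Seq[OF k(2)] k'(2) by (auto simp: relpowp_add)
  then show ?thesis unfolding wp_def using k k' by (intro exI[of _ "k + k'"] exI[of _ s'']) simp
qed

abbreviation cell :: "vname \<Rightarrow> nexp" where
  "cell x \<equiv> NCell x (NConst 0)"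

definition for_loop :: "vname \<Rightarrow> com \<Rightarrow> com" where
  "for_loop x P = Seq (AssignN x (NConst 0) (NConst 0))
     (While (NLess (cell x) (cell ''n'')) (Seq P (AssignN x (NConst 0) (NAdd (cell x) (NConst 1)))))"

text \<open>The counter advances after the body, so the body must establish \<open>I (Suc j)\<close>
  for the incremented memory. A pass adds \<open>5\<close> steps: unfolding \<open>While\<close>,
  deciding \<open>If\<close>, the increment and two discarded \<open>Skip\<close>s. The initial
  assignment with its \<open>Skip\<close> and the last test give the \<open>4\<close>.\<close>

lemma wp_for_loop:
  assumes cnt: "\<And>j s. I j s \<Longrightarrow> nmem s x 0 = j \<and> nmem s ''n'' 0 = n"
    and init: "I 0 (write_nat x 0 0 s)"
    and body: "\<And>j s. j < n \<Longrightarrow> I j s \<Longrightarrow>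
      wp orc P t (\<lambda>s'. I (Suc j) (write_nat x 0 (Suc (nmem s' x 0)) s')) s"
    and final: "\<And>s. I n s \<Longrightarrow> Q s"
  shows "wp orc (for_loop x P) (n * (t + 5) + 4) Q s"
proof -
  let ?b = "NLess (cell x) (cell ''n'')"
  let ?P = "Seq P (AssignN x (NConst 0) (NAdd (cell x) (NConst 1)))"
  have loop: "wp orc (While ?b ?P) (m * (t + 5) + 2) Q s" if "I j s" "j + m = n" for m j s
    using that
  proof (induction m arbitrary: j s)
    case 0
    then have "wp orc (While ?b ?P) (Suc (Suc 0)) Q s"
      using cnt[of j s] final
      by (intro wp_step[where P = "While ?b ?P"]) (auto intro!: wp_If wp_Skip)
    then show ?case by (simp add: numeral_2_eq_2)
  next
    case (Suc m)
    have "wp orc P t (\<lambda>s'. I (Suc j) (write_nat x 0 (Suc (nmem s' x 0)) s')) s"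
      using Suc.prems by (intro body) auto
    then have "wp orc P t (wp orc (AssignN x (NConst 0) (NAdd (cell x) (NConst 1))) 1 (I (Suc j))) s"
      by (rule wp_mono) (auto intro!: wp_AssignN[unfolded One_nat_def])
    then have "wp orc ?P (t + 1 + 1) (I (Suc j)) s" by (rule wp_Seq)
    then have "wp orc ?P (t + 1 + 1) (wp orc (While ?b ?P) (m * (t + 5) + 2) Q) s"
      by (rule wp_mono) (use Suc in auto)
    then have "wp orc (Seq ?P (While ?b ?P)) (t + 1 + 1 + (m * (t + 5) + 2) + 1) Q s"
      by (rule wp_Seq)
    then have "wp orc (If ?b (Seq ?P (While ?b ?P)) Skip)
        (Suc (t + 1 + 1 + (m * (t + 5) + 2) + 1)) Q s"
      using cnt[OF Suc.prems(1)] Suc.prems(2) by (intro wp_If) auto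
    then have "wp orc (While ?b ?P) (Suc (Suc (t + 1 + 1 + (m * (t + 5) + 2) + 1))) Q s"
      by (intro wp_step[where P = "While ?b ?P"]) auto
    then show ?case by (rule wp_mono) auto
  qed
  have "wp orc (for_loop x P) (1 + (n * (t + 5) + 2) + 1) Q s"
    unfolding for_loop_def using init loop by (intro wp_Seq wp_AssignN) auto
  then show ?thesis by (rule wp_mono) auto
qed


lemma wp_le: "wp orc P t Q s \<Longrightarrow> t \<le> t' \<Longrightarrow> wp orc P t' Q s"
  by (rule wp_mono)


section \<open>The program\<close>

lemma mem_write [simp]:
  "nmem (write_nat x i v s) = (nmem s)(x := (nmem s x)(i := v))"
  "rmem (write_nat x i v s) = rmem s"
  "nmem (write_real x i r s) = nmem s"
  "rmem (write_real x i r s) = (rmem s)(x := (rmem s x)(i := r))"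
  by (simp_all add: write_nat_def write_real_def)

definition frame :: "vname set \<Rightarrow> vname set \<Rightarrow> state \<Rightarrow> state \<Rightarrow> bool" where
  "frame X Y s s' \<longleftrightarrow> (\<forall>x. x \<notin> X \<longrightarrow> nmem s' x = nmem s x) \<and> (\<forall>y. y \<notin> Y \<longrightarrow> rmem s' y = rmem s y)"

lemma frameD:
  "frame X Y s s' \<Longrightarrow> x \<notin> X \<Longrightarrow> nmem s' x = nmem s x"
  "frame X Y s s' \<Longrightarrow> y \<notin> Y \<Longrightarrow> rmem s' y = rmem s y"
  by (simp_all add: frame_def)

lemma frame_refl: "frame X Y s s"
  by (simp add: frame_def)

lemma frame_write:
  "x \<in> X \<Longrightarrow> frame X Y s (write_nat x i v s') = frame X Y s s'"
  "y \<in> Y \<Longrightarrow> frame X Y s (write_real y i r s') = frame X Y s s'"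
  by (auto simp: frame_def)

definition live :: "state \<Rightarrow> nat set" where
  "live s = {j. nmem s ''in'' j \<noteq> 0}"

text \<open>All positions are processed, live or not: removing one outside \<open>U\<close> does not
  change the query and yields weight \<open>0\<close>, in agreement with
  \<open>w_outside\<close>.\<close>

definition marginals_com :: com where
  "marginals_com = for_loop ''i''
     (Seq (AssignN ''t'' (NConst 0) (NCell ''in'' (cell ''i'')))
     (Seq (AssignN ''in'' (cell ''i'') (NConst 0))
     (Seq (Query ''in'' ''w'' (cell ''i''))
     (Seq (AssignR ''w'' (cell ''i'') (RSub (RCell ''f'' (NConst 0)) (RCell ''w'' (cell ''i''))))
          (AssignN ''in'' (cell ''i'') (cell ''t''))))))"

lemma wp_marginals:
  assumes n: "nmem s ''n'' 0 = n" and f: "rmem s ''f'' 0 = real_of_int (orc (live s))"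
    and Q: "\<And>s'. frame {''i'', ''t''} {''w''} s s' \<Longrightarrow>
      (\<And>j. j < n \<Longrightarrow> rmem s' ''w'' j = real_of_int (orc (live s)) - real_of_int (orc (live s - {j}))) \<Longrightarrow>
      Q s'"
  shows "wp orc marginals_com (n * 14 + 4) Q s"
proof -
  define I where "I j s' \<longleftrightarrow> nmem s' ''i'' 0 = j \<and> frame {''i'', ''t''} {''w''} s s' \<and>
    (\<forall>l<j. rmem s' ''w'' l = real_of_int (orc (live s)) - real_of_int (orc (live s - {l})))" for j s'
  have "wp orc marginals_com (n * ((1 + (1 + (1 + (1 + 1 + 1) + 1) + 1) + 1) + 5) + 4) Q s"
    unfolding marginals_com_def
  proof (rule wp_for_loop[where I = I])
    show "nmem s' ''i'' 0 = j \<and> nmem s' ''n'' 0 = n" if "I j s'" for j s'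
      using that n frameD(1)[of _ _ s s' "''n''"] by (auto simp: I_def)
    show "I 0 (write_nat ''i'' 0 0 s)"
      by (simp add: I_def frame_write frame_refl)
    show "Q s'" if "I n s'" for s'
      using that by (intro Q) (auto simp: I_def)
    fix j s' assume "j < n" and I: "I j s'"
    then have i: "nmem s' ''i'' 0 = j" and fr: "frame {''i'', ''t''} {''w''} s s'"
      by (auto simp: I_def)
    have in': "nmem s' ''in'' = nmem s ''in''" and f': "rmem s' ''f'' = rmem s ''f''"
      by (simp_all add: frameD[OF fr])
    \<comment> \<open>\<open>sa\<close> is the state after the first two assignments;
      \<open>sb\<close>, \<open>sc\<close> and \<open>sd\<close> follow the query, the subtraction
      and the restoration.\<close>
    define sa where "sa = write_nat ''in'' j 0 (write_nat ''t'' 0 (nmem s' ''in'' j) s')"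
    define sb where "sb = write_real ''w'' j (real_of_int (orc (live sa))) sa"
    define sc where "sc = write_real ''w'' j (rmem sb ''f'' 0 - rmem sb ''w'' j) sb"
    define sd where "sd = write_nat ''in'' j (nmem sc ''t'' 0) sc"
    have live: "live sa = live s - {j}"
      by (auto simp: sa_def live_def in')
    have w: "rmem sd ''w'' = (rmem s' ''w'')(j := real_of_int (orc (live s)) - real_of_int (orc (live s - {j})))"
      by (simp add: sd_def sc_def sb_def live) (simp add: sa_def f' f)
    \<comment> \<open>Restoring the saved entry keeps \<open>in\<close> out of the exceptions of the
      frame, although the body writes to it.\<close>
    have "nmem sd ''in'' = nmem s' ''in''"
      by (simp add: sd_def sc_def sb_def sa_def)
    moreover have "nmem sd x = nmem s' x" if "x \<noteq> ''in''" "x \<noteq> ''t''" for x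
      using that by (simp add: sd_def sc_def sb_def sa_def)
    moreover have "rmem sd y = rmem s' y" if "y \<noteq> ''w''" for y
      using that by (simp add: sd_def sc_def sb_def sa_def)
    ultimately have "frame {''i'', ''t''} {''w''} s sd"
      using fr unfolding frame_def by (metis insertCI)
    then have I_sd: "I (Suc j) (write_nat ''i'' 0 (Suc (nmem sd ''i'' 0)) sd)"
      using I i by (auto simp: I_def frame_write w less_Suc_eq) (simp_all add: sd_def sc_def sb_def sa_def)
    show "wp orc
     (Seq (AssignN ''t'' (NConst 0) (NCell ''in'' (cell ''i'')))
     (Seq (AssignN ''in'' (cell ''i'') (NConst 0))
     (Seq (Query ''in'' ''w'' (cell ''i''))
     (Seq (AssignR ''w'' (cell ''i'') (RSub (RCell ''f'' (NConst 0)) (RCell ''w'' (cell ''i''))))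
          (AssignN ''in'' (cell ''i'') (cell ''t''))))))
      (1 + (1 + (1 + (1 + 1 + 1) + 1) + 1) + 1)
      (\<lambda>s'. I (Suc j) (write_nat ''i'' 0 (Suc (nmem s' ''i'' 0)) s')) s'"
      by ((rule wp_Seq wp_AssignN wp_AssignR wp_Query)+)
        (insert I_sd, simp add: sd_def sc_def sb_def sa_def live_def i)
  qed
  then show ?thesis by simp
qed

text \<open>\<open>b = n\<close> means that no candidate has been seen yet.\<close>

definition argmin_com :: "bexp \<Rightarrow> com" where
  "argmin_com L = Seq (AssignN ''b'' (NConst 0) (cell ''n'')) (for_loop ''i''
     (If (BAnd (NLess (NConst 0) (NCell ''in'' (cell ''i'')))
               (BNot (BAnd (NLess (cell ''b'') (cell ''n'')) (BNot L))))
         (AssignN ''b'' (NConst 0) (cell ''i'')) Skip))"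

text \<open>Serves both selections of a round. Transitivity is asked for \<open>lt\<close> followed
  by \<open>le\<close>, since cross-multiplied ratios are not transitive through an element whose
  cost and weight both vanish.\<close>

lemma wp_argmin:
  assumes n: "nmem s ''n'' 0 = n" and U: "live s \<subseteq> {..<n}" "live s \<noteq> {}"
    and L: "\<And>s'. frame {''i'', ''b''} {} s s' \<Longrightarrow> bval L s' \<longleftrightarrow> lt (nmem s' ''i'' 0) (nmem s' ''b'' 0)"
    and refl: "\<And>u. le u u"
    and lt: "\<And>u b v. u \<in> live s \<Longrightarrow> b \<in> live s \<Longrightarrow> v \<in> live s \<Longrightarrow> lt u b \<Longrightarrow> le b v \<Longrightarrow> le u v"
    and not_lt: "\<And>u b. \<not> lt u b \<Longrightarrow> le b u"
    and Q: "\<And>s'. frame {''i'', ''b''} {} s s' \<Longrightarrow> nmem s' ''b'' 0 \<in> live s \<Longrightarrow>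
      (\<And>v. v \<in> live s \<Longrightarrow> le (nmem s' ''b'' 0) v) \<Longrightarrow> Q s'"
  shows "wp orc (argmin_com L) (n * 7 + 6) Q s"
proof -
  define I where "I j s' \<longleftrightarrow> nmem s' ''i'' 0 = j \<and> frame {''i'', ''b''} {} s s' \<and>
    (if live s \<inter> {..<j} = {} then nmem s' ''b'' 0 = n
     else nmem s' ''b'' 0 \<in> live s \<and> (\<forall>v\<in>live s. v < j \<longrightarrow> le (nmem s' ''b'' 0) v))" for j s'
  let ?s0 = "write_nat ''b'' 0 n s"
  let ?P = "If (BAnd (NLess (NConst 0) (NCell ''in'' (cell ''i'')))
               (BNot (BAnd (NLess (cell ''b'') (cell ''n'')) (BNot L))))
         (AssignN ''b'' (NConst 0) (cell ''i'')) Skip"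
  have "wp orc (for_loop ''i'' ?P) (n * (2 + 5) + 4) Q ?s0"
  proof (rule wp_for_loop[where I = I])
    show "nmem s' ''i'' 0 = j \<and> nmem s' ''n'' 0 = n" if "I j s'" for j s'
      using that n frameD(1)[of _ _ s s' "''n''"] by (auto simp: I_def)
    show "I 0 (write_nat ''i'' 0 0 ?s0)"
      by (simp add: I_def frame_write frame_refl)
    show "Q s'" if "I n s'" for s'
      using that U by (intro Q) (auto simp: I_def Int_absorb2 split: if_splits)
    fix j s' assume j: "j < n" and I: "I j s'"
    then have i: "nmem s' ''i'' 0 = j" and fr: "frame {''i'', ''b''} {} s s'"
      by (auto simp: I_def)
    let ?b = "nmem s' ''b'' 0"
    have live: "nmem s' ''in'' j \<noteq> 0 \<longleftrightarrow> j \<in> live s" and n': "nmem s' ''n'' 0 = n"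
      using n frameD(1)[OF fr, of "''in''"] frameD(1)[OF fr, of "''n''"] by (auto simp: live_def)
    have Lj: "bval L s' \<longleftrightarrow> lt j ?b" using L[OF fr] i by simp
    have split: "live s \<inter> {..<Suc j} = (if j \<in> live s then insert j else id) (live s \<inter> {..<j})"
      by (auto simp: less_Suc_eq)
    show "wp orc ?P 2 (\<lambda>s'. I (Suc j) (write_nat ''i'' 0 (Suc (nmem s' ''i'' 0)) s')) s'"
    proof (cases "j \<in> live s \<and> \<not> (?b < n \<and> \<not> lt j ?b)")
      case True
      have "le j v" if v: "v \<in> live s" "v < Suc j" for v
      proof (cases "v = j")
        case False
        then have "v \<in> live s \<inter> {..<j}" using v by auto
        then have "?b \<in> live s" "le ?b v" using I by (auto simp: I_def split: if_splits)
        \<comment> \<open>A candidate exists, so \<open>?b < n\<close> and the test can only have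
          succeeded through \<open>lt j ?b\<close>.\<close>
        then show ?thesis using True U v lt[of j ?b v] by auto
      qed (simp add: refl)
      then have "wp orc (AssignN ''b'' (NConst 0) (cell ''i'')) 1
          (\<lambda>s'. I (Suc j) (write_nat ''i'' 0 (Suc (nmem s' ''i'' 0)) s')) s'"
        using i fr True by (intro wp_AssignN) (auto simp: I_def frame_write split)
      then have "wp orc ?P (Suc 1) (\<lambda>s'. I (Suc j) (write_nat ''i'' 0 (Suc (nmem s' ''i'' 0)) s')) s'"
        using True live n' Lj i by (intro wp_If) simp
      then show ?thesis by (rule wp_le) simp
    next
      case False
      have "I (Suc j) (write_nat ''i'' 0 (Suc (nmem s' ''i'' 0)) s')"
      proof (cases "j \<in> live s")
        case True
        then have "le ?b j" "?b < n" using False not_lt by auto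
        then show ?thesis using I True
          by (auto simp: I_def frame_write split less_Suc_eq split: if_splits)
      next
        case False
        then show ?thesis using I by (auto simp: I_def frame_write split less_Suc_eq)
      qed
      then have "wp orc ?P (Suc 0) (\<lambda>s'. I (Suc j) (write_nat ''i'' 0 (Suc (nmem s' ''i'' 0)) s')) s'"
        using False live n' Lj i by (intro wp_If) (auto intro: wp_Skip)
      then show ?thesis by (rule wp_le) simp
    qed
  qed
  then have "wp orc (argmin_com L) (1 + (n * (2 + 5) + 4) + 1) Q s"
    unfolding argmin_com_def using n by (intro wp_Seq wp_AssignN) simp
  then show ?thesis by (rule wp_le) simp
qed

definition charge_com :: com where
  "charge_com = for_loop ''i''
     (AssignR ''cost'' (cell ''i'') (RSub (RCell ''cost'' (cell ''i''))
        (RMul (RCell ''d'' (NConst 0)) (RCell ''w'' (cell ''i'')))))"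

lemma wp_charge:
  assumes n: "nmem s ''n'' 0 = n"
    and Q: "\<And>s'. frame {''i''} {''cost''} s s' \<Longrightarrow>
      (\<And>j. j < n \<Longrightarrow> rmem s' ''cost'' j = rmem s ''cost'' j - rmem s ''d'' 0 * rmem s ''w'' j) \<Longrightarrow> Q s'"
  shows "wp orc charge_com (n * 6 + 4) Q s"
proof -
  define I where "I j s' \<longleftrightarrow> nmem s' ''i'' 0 = j \<and> frame {''i''} {''cost''} s s' \<and>
    (\<forall>l. rmem s' ''cost'' l = rmem s ''cost'' l - (if l < j then rmem s ''d'' 0 * rmem s ''w'' l else 0))" for j s'
  have "wp orc charge_com (n * (1 + 5) + 4) Q s"
    unfolding charge_com_def
  proof (rule wp_for_loop[where I = I])
    show "nmem s' ''i'' 0 = j \<and> nmem s' ''n'' 0 = n" if "I j s'" for j s'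
      using that n frameD(1)[of _ _ s s' "''n''"] by (auto simp: I_def)
    show "I 0 (write_nat ''i'' 0 0 s)"
      by (simp add: I_def frame_write frame_refl)
    show "Q s'" if "I n s'" for s'
      using that by (intro Q) (auto simp: I_def)
    fix j s' assume "j < n" and I: "I j s'"
    then have fr: "frame {''i''} {''cost''} s s'" by (simp add: I_def)
    have "rmem s' ''d'' = rmem s ''d''" "rmem s' ''w'' = rmem s ''w''"
      using frameD(2)[OF fr, of "''d''"] frameD(2)[OF fr, of "''w''"] by auto
    then show "wp orc (AssignR ''cost'' (cell ''i'') (RSub (RCell ''cost'' (cell ''i''))
        (RMul (RCell ''d'' (NConst 0)) (RCell ''w'' (cell ''i''))))) 1
        (\<lambda>s'. I (Suc j) (write_nat ''i'' 0 (Suc (nmem s' ''i'' 0)) s')) s'"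
      using I by (intro wp_AssignR) (auto simp: I_def frame_write less_Suc_eq)
  qed
  then show ?thesis by simp
qed

text \<open>Ratios \<open>cost / w\<close> are compared by cross multiplication, because \<open>w\<close> may vanish.\<close>

definition ratio_less :: bexp where
  "ratio_less = RLess (RMul (RCell ''cost'' (cell ''i'')) (RCell ''w'' (cell ''b'')))
                      (RMul (RCell ''cost'' (cell ''b'')) (RCell ''w'' (cell ''i'')))"

definition marginal_less :: bexp where
  "marginal_less = RLess (RCell ''w'' (cell ''i'')) (RCell ''w'' (cell ''b''))"

text \<open>If the chosen weight is \<open>0\<close>, the machine quotient is \<open>0\<close>,
  exactly as in \<open>inv_delete\<close>.\<close>

definition delete_com :: com where
  "delete_com = Seq (argmin_com ratio_less)
     (Seq (AssignR ''d'' (NConst 0) (RDiv (RCell ''cost'' (cell ''b'')) (RCell ''w'' (cell ''b''))))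
     (Seq charge_com (AssignN ''out'' (cell ''b'') (NConst 1))))"

text \<open>\<open>n - k\<close> stands for \<open>card U\<close>, by the cardinality clause of
  \<open>inv\<close>; this avoids a counting loop.\<close>

definition dense_test :: bexp where
  "dense_test = RLess
     (RMul (RMul (RAdd (RConst 1) (RCell ''eps'' (NConst 0))) (RCell ''rho'' (NConst 0)))
           (RNat (NSub (cell ''n'') (cell ''k''))))
     (RCell ''f'' (NConst 0))"

text \<open>Both branches leave the chosen element in \<open>b\<close>, so its removal from
  \<open>U\<close> is shared; only \<open>delete_com\<close> writes to \<open>out\<close>.\<close>

definition round_com :: com where
  "round_com = Seq (Query ''in'' ''f'' (NConst 0)) (Seq marginals_com
     (Seq (If dense_test delete_com (argmin_com marginal_less))
          (AssignN ''in'' (cell ''b'') (NConst 0))))"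

definition density_deletion_com :: com where
  "density_deletion_com = Seq (for_loop ''i'' (AssignN ''in'' (cell ''i'') (NConst 1)))
     (for_loop ''k'' round_com)"

text \<open>The strict comparison makes \<open>cb\<close> nonzero, so it can be cancelled after
  chaining the two inequalities.\<close>

lemma ratio_trans:
  fixes cu :: real
  assumes "0 \<le> cu" "0 \<le> cv" "0 \<le> wb" "cu * wb < cb * wu" "cb * wv \<le> cv * wb" "0 \<le> cb"
  shows "cu * wv \<le> cv * wu"
proof -
  have "cb \<noteq> 0" using assms by (metis mult_nonneg_nonneg mult_zero_left not_le)
  have "cb * (cu * wv) \<le> cu * (cv * wb)" using mult_left_mono[OF assms(5,1)] by (simp add: ac_simps)
  also have "\<dots> \<le> cv * (cb * wu)"
    using mult_left_mono[OF less_imp_le[OF assms(4)] assms(2)] by (simp add: ac_simps)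
  finally have "cb * (cu * wv) \<le> cb * (cv * wu)" by (simp add: ac_simps)
  then show ?thesis using \<open>cb \<noteq> 0\<close> assms(6) by simp
qed

text \<open>With positions as ground set, the arrays \<open>in\<close> and \<open>out\<close>
  directly represent \<open>U\<close> and \<open>S\<close>.\<close>

locale machine = local_ratio "{..<n}" f c \<rho> \<epsilon> C for n :: nat and f c \<rho> \<epsilon> C
begin

definition state_inv :: "nat \<Rightarrow> state \<Rightarrow> bool" where
  "state_inv k s \<longleftrightarrow> nmem s ''n'' 0 = n \<and> nmem s ''k'' 0 = k \<and>
     rmem s ''rho'' 0 = \<rho> \<and> rmem s ''eps'' 0 = \<epsilon> \<and>
     inv k (live s) {j. nmem s ''out'' j \<noteq> 0} (rmem s ''cost'')"

text \<open>Shaped like the body premise of \<open>wp_for_loop\<close>, whose increment of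
  \<open>k\<close> closes the round.\<close>

definition round_post :: "nat \<Rightarrow> state \<Rightarrow> bool" where
  "round_post k s \<longleftrightarrow> state_inv (Suc k) (write_nat ''k'' 0 (Suc (nmem s ''k'' 0)) s)"

lemma round_postI:
  assumes "nmem s ''n'' 0 = n" "nmem s ''k'' 0 = k" "rmem s ''rho'' 0 = \<rho>" "rmem s ''eps'' 0 = \<epsilon>"
    and "inv (Suc k) U S (rmem s ''cost'')" "live s = U" "{j. nmem s ''out'' j \<noteq> 0} = S"
  shows "round_post k s"
  using assms by (simp add: round_post_def state_inv_def live_def)

lemma wp_round:
  assumes k: "k < n" and inv_s: "state_inv k s"
  shows "wp f round_com (n * 27 + 40) (round_post k) s"
proof -
  let ?U = "live s" and ?S = "{j. nmem s ''out'' j \<noteq> 0}"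
  \<comment> \<open>Each branch must reach a state from which clearing \<open>in[b]\<close>
    completes the round.\<close>
  let ?Q = "wp f (AssignN ''in'' (cell ''b'') (NConst 0)) 1 (round_post k)"
  have mem: "nmem s ''n'' 0 = n" "nmem s ''k'' 0 = k" "rmem s ''rho'' 0 = \<rho>" "rmem s ''eps'' 0 = \<epsilon>"
    and inv: "inv k ?U ?S (rmem s ''cost'')"
    using inv_s by (auto simp: state_inv_def)
  then have UV: "?U \<subseteq> {..<n}" and cardU: "card ?U = n - k"
    and c0: "\<And>u. u < n \<Longrightarrow> 0 \<le> rmem s ''cost'' u"
    by (auto simp: inv_def)
  have U_ne: "?U \<noteq> {}" using cardU k by auto
  have decide: "wp f (If dense_test delete_com (argmin_com marginal_less)) (n * 13 + 20) ?Q s2"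
    if fr2: "frame {''i'', ''t''} {''f'', ''w''} s s2" and f2: "rmem s2 ''f'' 0 = real_of_int (f ?U)"
      and w2: "\<And>j. j < n \<Longrightarrow> rmem s2 ''w'' j = w ?U j" for s2
  proof -
    note eqs2 = frameD[OF fr2]
    have live2: "live s2 = ?U" by (simp add: live_def eqs2)
    have n2: "nmem s2 ''n'' 0 = n" by (simp add: eqs2 mem)
    have test: "bval dense_test s2 \<longleftrightarrow> (1 + \<epsilon>) * \<rho> * real (card ?U) < real_of_int (f ?U)"
      by (simp add: dense_test_def eqs2 mem f2 cardU)
    have wU: "0 \<le> rmem s2 ''w'' u" if "u \<in> ?U" for u
      using that UV w2 w_nonneg[of ?U u] by auto
    show ?thesis
    proof (cases "bval dense_test s2")
      case True
      \<comment> \<open>Minimality for cross-multiplied ratios is the hypothesis \<open>best\<close>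
        of \<open>inv_delete\<close>; \<open>ratio_trans\<close> supplies the mixed
        transitivity.\<close>
      have "wp f delete_com ((n * 7 + 6) + (1 + ((n * 6 + 4) + 1 + 1) + 1) + 1) ?Q s2"
        unfolding delete_com_def
      proof (rule wp_Seq, rule wp_argmin[where s = s2 and n = n and
            lt = "\<lambda>u b. rmem s2 ''cost'' u * rmem s2 ''w'' b < rmem s2 ''cost'' b * rmem s2 ''w'' u" and
            le = "\<lambda>b v. rmem s2 ''cost'' b * rmem s2 ''w'' v \<le> rmem s2 ''cost'' v * rmem s2 ''w'' b"])
        show "bval ratio_less s' \<longleftrightarrow>
            rmem s2 ''cost'' (nmem s' ''i'' 0) * rmem s2 ''w'' (nmem s' ''b'' 0)
            < rmem s2 ''cost'' (nmem s' ''b'' 0) * rmem s2 ''w'' (nmem s' ''i'' 0)"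
          if "frame {''i'', ''b''} {} s2 s'" for s'
          by (simp add: ratio_less_def frameD[OF that])
        show "rmem s2 ''cost'' u * rmem s2 ''w'' v \<le> rmem s2 ''cost'' v * rmem s2 ''w'' u"
          if "u \<in> live s2" "b \<in> live s2" "v \<in> live s2"
            "rmem s2 ''cost'' u * rmem s2 ''w'' b < rmem s2 ''cost'' b * rmem s2 ''w'' u"
            "rmem s2 ''cost'' b * rmem s2 ''w'' v \<le> rmem s2 ''cost'' v * rmem s2 ''w'' b" for u b v
          using that c0 wU UV unfolding live2 by (intro ratio_trans[OF _ _ _ that(4,5)]) (auto simp: eqs2)
      next
        fix s3 assume fr3: "frame {''i'', ''b''} {} s2 s3" and b: "nmem s3 ''b'' 0 \<in> live s2"
          and best: "\<And>v. v \<in> live s2 \<Longrightarrow> rmem s2 ''cost'' (nmem s3 ''b'' 0) * rmem s2 ''w'' v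
            \<le> rmem s2 ''cost'' v * rmem s2 ''w'' (nmem s3 ''b'' 0)"
        note eqs3 = frameD[OF fr3]
        let ?b = "nmem s3 ''b'' 0"
        let ?s4 = "write_real ''d'' 0 (rmem s3 ''cost'' ?b / rmem s3 ''w'' ?b) s3"
        have bU: "?b \<in> ?U" and bn: "?b < n" using b UV by (auto simp: live2)
        have "wp f (Seq charge_com (AssignN ''out'' (cell ''b'') (NConst 1))) (n * 6 + 4 + 1 + 1) ?Q ?s4"
        proof (rule wp_Seq, rule wp_charge[where n = n])
          show "nmem ?s4 ''n'' 0 = n" by (simp add: eqs3 eqs2 mem)
          fix s5 assume fr5: "frame {''i''} {''cost''} ?s4 s5"
            and cost5: "\<And>j. j < n \<Longrightarrow>
              rmem s5 ''cost'' j = rmem ?s4 ''cost'' j - rmem ?s4 ''d'' 0 * rmem ?s4 ''w'' j"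
          note eqs5 = frameD[OF fr5]
          have cost: "rmem s5 ''cost'' u = rmem s ''cost'' u - rmem s ''cost'' ?b / w ?U ?b * w ?U u"
            if "u \<in> {..<n}" for u
            using cost5[of u] that bn by (simp add: eqs3 eqs2 w2)
          have "inv (Suc k) (?U - {?b}) (insert ?b ?S) (rmem s5 ''cost'')"
            using inv bU _ _ cost
          proof (rule inv_delete)
            show "(1 + \<epsilon>) * \<rho> * real (card ?U) < real_of_int (f ?U)" using True test by simp
            show "rmem s ''cost'' ?b * w ?U u \<le> rmem s ''cost'' u * w ?U ?b" if "u \<in> ?U" for u
              using best[of u] that UV bn by (auto simp: live2 w2 eqs2)
          qed
          then have "round_post k (write_nat ''in'' ?b 0 (write_nat ''out'' ?b 1 s5))"
            by (intro round_postI[where U = "?U - {?b}" and S = "insert ?b ?S"])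
              (auto simp: live_def eqs5 eqs3 eqs2 mem)
          then show "wp f (AssignN ''out'' (cell ''b'') (NConst 1)) 1 ?Q s5"
            by (intro wp_AssignN) (simp add: eqs5)
        qed
        then show "wp f (Seq (AssignR ''d'' (NConst 0)
              (RDiv (RCell ''cost'' (cell ''b'')) (RCell ''w'' (cell ''b''))))
            (Seq charge_com (AssignN ''out'' (cell ''b'') (NConst 1))))
            (1 + (n * 6 + 4 + 1 + 1) + 1) ?Q s3"
          by - (rule wp_Seq, rule wp_AssignR, simp)
      qed (use n2 UV U_ne live2 in auto)
      then have "wp f delete_com (n * 13 + 15) ?Q s2" by (rule wp_le) simp
      then show ?thesis using True by (intro wp_le[OF wp_If]) auto
    next
      case False
      have "wp f (argmin_com marginal_less) (n * 7 + 6) ?Q s2"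
      proof (rule wp_argmin[where lt = "\<lambda>u b. rmem s2 ''w'' u < rmem s2 ''w'' b" and
            le = "\<lambda>b v. rmem s2 ''w'' b \<le> rmem s2 ''w'' v"])
        show "bval marginal_less s' \<longleftrightarrow> rmem s2 ''w'' (nmem s' ''i'' 0) < rmem s2 ''w'' (nmem s' ''b'' 0)"
          if "frame {''i'', ''b''} {} s2 s'" for s'
          by (simp add: marginal_less_def frameD[OF that])
      next
        fix s3 assume fr3: "frame {''i'', ''b''} {} s2 s3" and b: "nmem s3 ''b'' 0 \<in> live s2"
          and best: "\<And>v. v \<in> live s2 \<Longrightarrow> rmem s2 ''w'' (nmem s3 ''b'' 0) \<le> rmem s2 ''w'' v"
        note eqs3 = frameD[OF fr3]
        let ?b = "nmem s3 ''b'' 0"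
        have bU: "?b \<in> ?U" and bn: "?b < n" using b UV by (auto simp: live2)
        have "inv (Suc k) (?U - {?b}) ?S (rmem s ''cost'')"
          using inv bU
        proof (rule inv_peel)
          show "real_of_int (f ?U) \<le> (1 + \<epsilon>) * \<rho> * real (card ?U)" using False test by simp
          show "w ?U ?b \<le> w ?U u" if "u \<in> ?U" for u
            using best[of u] that UV bn by (auto simp: live2 w2)
        qed
        then have "round_post k (write_nat ''in'' ?b 0 s3)"
          by (intro round_postI[where U = "?U - {?b}" and S = ?S])
            (auto simp: live_def eqs3 eqs2 mem)
        then show "?Q s3"
          by (intro wp_AssignN) simp
      qed (use n2 UV U_ne live2 in auto)
      then show ?thesis using False by (intro wp_le[OF wp_If]) auto
    qed
  qed
  let ?s1 = "write_real ''f'' 0 (real_of_int (f ?U)) s"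
  have "wp f (Seq marginals_com
     (Seq (If dense_test delete_com (argmin_com marginal_less))
          (AssignN ''in'' (cell ''b'') (NConst 0))))
     ((n * 14 + 4) + ((n * 13 + 20) + 1 + 1) + 1) (round_post k) ?s1"
  proof (rule wp_Seq, rule wp_marginals[where n = n])
    have live1: "live ?s1 = ?U" by (simp add: live_def)
    show "nmem ?s1 ''n'' 0 = n" "rmem ?s1 ''f'' 0 = real_of_int (f (live ?s1))"
      using live1 mem by auto
    fix s2 assume fr: "frame {''i'', ''t''} {''w''} ?s1 s2"
      and w2: "\<And>j. j < n \<Longrightarrow> rmem s2 ''w'' j
        = real_of_int (f (live ?s1)) - real_of_int (f (live ?s1 - {j}))"
    have "frame {''i'', ''t''} {''f'', ''w''} s s2"
      using fr by (auto simp: frame_def)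
    moreover have "rmem s2 ''f'' 0 = real_of_int (f ?U)"
      by (simp add: frameD[OF fr])
    moreover have "rmem s2 ''w'' j = w ?U j" if "j < n" for j
      using w2[OF that] by (simp add: live1 w_def)
    ultimately show "wp f (Seq (If dense_test delete_com (argmin_com marginal_less))
          (AssignN ''in'' (cell ''b'') (NConst 0))) ((n * 13 + 20) + 1 + 1) (round_post k) s2"
      by (intro wp_Seq decide)
  qed
  then have "wp f round_com (1 + ((n * 14 + 4) + ((n * 13 + 20) + 1 + 1) + 1) + 1) (round_post k) s"
    unfolding round_com_def by - (rule wp_Seq, rule wp_Query, simp add: live_def)
  then show ?thesis by (rule wp_le) simp
qed

text \<open>A linear initialization and \<open>n\<close> linear rounds, with constants rounded up.
  The whole natural-number memory is prescribed so that \<open>out\<close> starts empty and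
  \<open>in\<close> is \<open>0\<close> from position \<open>n\<close> on.\<close>

lemma wp_density_deletion:
  assumes s: "nmem s = (\<lambda>x i. if x = ''n'' \<and> i = 0 then n else 0)"
    "rmem s ''rho'' 0 = \<rho>" "rmem s ''eps'' 0 = \<epsilon>"
    and cost: "\<And>i. i < n \<Longrightarrow> rmem s ''cost'' i = c i"
  shows "wp f density_deletion_com (n * n * 30 + n * 60 + 10) (state_inv n) s"
proof -
  define I where "I j s' \<longleftrightarrow> nmem s' ''i'' 0 = j \<and> frame {''i'', ''in''} {} s s' \<and>
    nmem s' ''in'' = (\<lambda>l. of_bool (l < j))" for j s'
  have init: "wp f (for_loop ''i'' (AssignN ''in'' (cell ''i'') (NConst 1))) (n * (1 + 5) + 4)
      (\<lambda>s'. state_inv 0 (write_nat ''k'' 0 0 s')) s"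
  proof (rule wp_for_loop[where I = I])
    show "nmem s' ''i'' 0 = j \<and> nmem s' ''n'' 0 = n" if "I j s'" for j s'
      using that s(1) frameD(1)[of _ _ s s' "''n''"] by (auto simp: I_def)
    show "I 0 (write_nat ''i'' 0 0 s)"
      using s(1) by (auto simp: I_def frame_write frame_refl)
    show "state_inv 0 (write_nat ''k'' 0 0 s')" if "I n s'" for s'
    proof -
      have fr: "frame {''i'', ''in''} {} s s'" and in': "nmem s' ''in'' = (\<lambda>l. of_bool (l < n))"
        using that by (auto simp: I_def)
      have "inv 0 {..<n} {} (rmem s ''cost'')"
        using cost by (intro inv_init) auto
      then show ?thesis
        using s by (simp add: state_inv_def live_def in' frameD[OF fr] lessThan_def)
    qed
    fix j s' assume "j < n" and I: "I j s'"
    then show "wp f (AssignN ''in'' (cell ''i'') (NConst 1)) 1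
        (\<lambda>s'. I (Suc j) (write_nat ''i'' 0 (Suc (nmem s' ''i'' 0)) s')) s'"
      by (intro wp_AssignN) (auto simp: I_def frame_write less_Suc_eq)
  qed
  have "wp f (for_loop ''k'' round_com) (n * (n * 27 + 40 + 5) + 4) (state_inv n) s'"
    if "state_inv 0 (write_nat ''k'' 0 0 s')" for s'
    using wp_round that unfolding round_post_def
    by (intro wp_for_loop[where I = state_inv]) (auto simp: state_inv_def)
  then have "wp f density_deletion_com ((n * (1 + 5) + 4) + (n * (n * 27 + 40 + 5) + 4) + 1)
      (state_inv n) s"
    unfolding density_deletion_com_def by (intro wp_Seq wp_mono[OF init]) auto
  then show ?thesis by (rule wp_le) (simp add: algebra_simps)
qed

end


section \<open>Ground sets presented as lists\<close>

lemma indexed_subset_image: "indexed_subset vs I = (!) vs ` (I \<inter> {..<length vs})"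
  by (auto simp: indexed_subset_def)

lemma indexed_subset_subset: "indexed_subset vs I \<subseteq> set vs"
  by (auto simp: indexed_subset_def)

lemma indexed_subset_Un: "indexed_subset vs (I \<union> J) = indexed_subset vs I \<union> indexed_subset vs J"
  by (auto simp: indexed_subset_def)

lemma indexed_subset_mono: "I \<subseteq> J \<Longrightarrow> indexed_subset vs I \<subseteq> indexed_subset vs J"
  by (auto simp: indexed_subset_def)

lemma indexed_subset_singleton: "i < length vs \<Longrightarrow> indexed_subset vs {i} = {vs ! i}"
  by (auto simp: indexed_subset_def)

lemma indexed_subset_preimage:
  assumes "A \<subseteq> set vs"
  shows "indexed_subset vs {i. i < length vs \<and> vs ! i \<in> A} = A"
  using assms by (fastforce simp: indexed_subset_def in_set_conv_nth)

context
  fixes vs :: "'a list"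
  assumes dist: "distinct vs"
begin

section \<open>The bijection between positions and elements\<close>

lemma inj_nth: "I \<subseteq> {..<length vs} \<Longrightarrow> inj_on ((!) vs) I"
  using dist by (intro inj_on_nth) auto

lemma indexed_subset_Int: "indexed_subset vs (I \<inter> J) = indexed_subset vs I \<inter> indexed_subset vs J"
  using dist by (auto simp: indexed_subset_def nth_eq_iff_index_eq)

lemma indexed_subset_Diff: "indexed_subset vs (I - J) = indexed_subset vs I - indexed_subset vs J"
  using dist by (auto simp: indexed_subset_def nth_eq_iff_index_eq)

lemma card_indexed_subset: "I \<subseteq> {..<length vs} \<Longrightarrow> card (indexed_subset vs I) = card I"
  by (simp add: indexed_subset_image Int_absorb2 card_image inj_nth)

lemma sum_indexed_subset:
  "I \<subseteq> {..<length vs} \<Longrightarrow> sum h (indexed_subset vs I) = (\<Sum>i\<in>I. h (vs ! i))"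
  by (simp add: indexed_subset_image Int_absorb2 sum.reindex inj_nth)

text \<open>Distinctness makes \<open>indexed_subset vs\<close> respect intersections, differences
  and sums, so the properties of \<open>f\<close> transfer. \<open>C\<close> is the parameter of
  \<open>f\<close> on \<open>set vs\<close>, as the final guarantee demands.\<close>

lemma machine_value_oracle:
  assumes "normalized_fun f" "nondecreasing_on (set vs) f" "supermodular_on (set vs) f"
    and "\<And>u. u \<in> set vs \<Longrightarrow> 0 \<le> c u" "0 < \<epsilon>"
  shows "machine (length vs) (value_oracle vs f) (\<lambda>i. c (vs ! i)) \<epsilon> (c_param (set vs) f)"
proof
  let ?n = "length vs" and ?g = "value_oracle vs f"
  show "normalized_fun ?g"
    using assms(1) by (simp add: normalized_fun_def value_oracle_def indexed_subset_def)
  show "nondecreasing_on {..<?n} ?g"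
    unfolding nondecreasing_on_def value_oracle_def
  proof (intro allI impI)
    fix A B assume "A \<subseteq> B \<and> B \<subseteq> {..<?n}"
    then have "indexed_subset vs A \<subseteq> indexed_subset vs B" by (simp add: indexed_subset_mono)
    then show "f (indexed_subset vs A) \<le> f (indexed_subset vs B)"
      using assms(2) indexed_subset_subset unfolding nondecreasing_on_def by metis
  qed
  show "supermodular_on {..<?n} ?g"
    unfolding supermodular_on_def value_oracle_def indexed_subset_Int indexed_subset_Un
    using assms(3)[unfolded supermodular_on_def, rule_format, OF conjI, OF indexed_subset_subset indexed_subset_subset]
    by (intro allI impI)
  show "1 \<le> c_param (set vs) f" using assms by (intro c_param_ge_1) auto
  fix S assume S: "S \<subseteq> {..<?n}"
  have "(\<Sum>u\<in>S. ?g S - ?g (S - {u}))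
      = (\<Sum>u\<in>S. f (indexed_subset vs S) - f (indexed_subset vs S - {vs ! u}))"
    using S by (intro sum.cong) (auto simp: value_oracle_def indexed_subset_Diff indexed_subset_singleton)
  also have "\<dots> = (\<Sum>u\<in>indexed_subset vs S. f (indexed_subset vs S) - f (indexed_subset vs S - {u}))"
    using S by (simp add: sum_indexed_subset)
  finally show "real_of_int (\<Sum>u\<in>S. ?g S - ?g (S - {u})) \<le> c_param (set vs) f * real_of_int (?g S)"
    using sum_marginals_le_c_param[OF finite_set assms(1,2) indexed_subset_subset[of vs S]]
    by (simp add: value_oracle_def)
qed (use assms in auto)

end

theorem theorem1p5:
  "\<exists>(P :: com) (T :: nat poly).
     \<forall>(V :: 'a set) (vs :: 'a list) (f :: 'a set \<Rightarrow> int) (c :: 'a \<Rightarrow> real) (\<rho> :: real) (\<epsilon> :: real).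
       set vs = V \<and> distinct vs \<and>
       normalized_fun f \<and> nondecreasing_on V f \<and> supermodular_on V f \<and>
       (\<forall>u\<in>V. 0 \<le> c u) \<and> 0 < \<epsilon> \<and> \<epsilon> < 1 \<longrightarrow>
       (let t = poly T (card V); R = returned_set P vs f c \<rho> \<epsilon> t in
          halts_within P vs f c \<rho> \<epsilon> t \<and>
          (\<forall>S\<in>set_pmf R. S \<subseteq> V \<and> max_density_le (V - S) f (c_param V f * (1 + \<epsilon>) * \<rho>)) \<and>
          measure_pmf.expectation R (\<lambda>S. \<Sum>u\<in>S. c u)
            \<le> c_param V f * (1 + 1 / \<epsilon>) * supmod_dd_opt V f c \<rho>)"
\<comment> \<open>The coefficients, constant term first, are those of the time bound in
  \<open>wp_density_deletion\<close>.\<close>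
proof (rule exI[of _ density_deletion_com], rule exI[of _ "[:10, 60, 30:]"], intro allI impI)
  fix V :: "'a set" and vs :: "'a list" and f :: "'a set \<Rightarrow> int" and c :: "'a \<Rightarrow> real"
    and \<rho> \<epsilon> :: real
  assume *: "set vs = V \<and> distinct vs \<and>
       normalized_fun f \<and> nondecreasing_on V f \<and> supermodular_on V f \<and>
       (\<forall>u\<in>V. 0 \<le> c u) \<and> 0 < \<epsilon> \<and> \<epsilon> < 1"
  let ?n = "length vs" and ?g = "value_oracle vs f" and ?t = "poly [:10, 60, 30:] (card V)"
  have V: "V = set vs" and dist: "distinct vs" and finV: "finite V" and cardV: "card V = ?n"
    using * by (auto simp: distinct_card)
  note idx = indexed_subset_subset indexed_subset_preimage card_indexed_subset[OF dist]
    sum_indexed_subset[OF dist]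
  interpret machine ?n ?g "\<lambda>i. c (vs ! i)" \<rho> \<epsilon> "c_param V f"
    unfolding V using * by (intro machine_value_oracle) auto
  have "wp ?g density_deletion_com (?n * ?n * 30 + ?n * 60 + 10) (state_inv ?n) (input_state vs c \<rho> \<epsilon>)"
    by (intro wp_density_deletion) (auto simp: input_state_def)
  moreover have "?n * ?n * 30 + ?n * 60 + 10 = ?t" by (simp add: cardV algebra_simps)
  ultimately have "wp ?g density_deletion_com ?t (state_inv ?n) (input_state vs c \<rho> \<epsilon>)" by simp
  then obtain s where run: "run ?g ?t (density_deletion_com, input_state vs c \<rho> \<epsilon>) = return_pmf (Skip, s)"
    and s: "state_inv ?n s"
    by (rule wp_run)
  define S where "S = {j. nmem s ''out'' j \<noteq> 0}"
  have "inv (card {..<?n}) (live s) S (rmem s ''cost'')"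
    using s by (simp add: state_inv_def S_def)
  note S = inv_final[OF this]
  let ?S = "indexed_subset vs S"
  \<comment> \<open>The output is a point mass, so the support condition and the expectation both
    reduce to \<open>?S\<close>.\<close>
  have R: "returned_set density_deletion_com vs f c \<rho> \<epsilon> ?t = return_pmf ?S"
    by (simp only: returned_set_def run_instance_def run) (simp add: output_set_def S_def)
  have "max_density_le (V - ?S) f (c_param V f * (1 + \<epsilon>) * \<rho>)"
    unfolding max_density_le_iff[OF finite_Diff[OF finV]]
  proof (intro allI impI)
    fix A assume A: "A \<subseteq> V - ?S \<and> A \<noteq> {}"
    \<comment> \<open>Pulled back to positions, \<open>A\<close> is disjoint from \<open>S\<close>,
      so the density bound of \<open>inv_final\<close> applies.\<close>
    define I where "I = {i. i < ?n \<and> vs ! i \<in> A}"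
    have I: "I \<subseteq> {..<?n} - S" using A by (auto simp: I_def indexed_subset_def)
    have "indexed_subset vs I = A" using A unfolding I_def V by (intro idx) auto
    moreover have "card (indexed_subset vs I) = card I" using I by (intro idx) auto
    ultimately show "real_of_int (f A) \<le> c_param V f * (1 + \<epsilon>) * \<rho> * real (card A)"
      using S(2)[OF I] by (simp add: value_oracle_def)
  qed
  moreover have "(\<Sum>u\<in>?S. c u) \<le> c_param V f * (1 + 1 / \<epsilon>) * supmod_dd_opt V f c \<rho>"
  proof -
    obtain J where J: "J \<subseteq> V" "max_density_le (V - J) f \<rho>" "supmod_dd_opt V f c \<rho> = (\<Sum>u\<in>J. c u)"
      by (rule supmod_dd_opt_attained[OF finV])
    \<comment> \<open>An optimal solution, pulled back to positions, is the feasible set against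
      which \<open>inv_final\<close> compares the cost.\<close>
    define J' where "J' = {i. i < ?n \<and> vs ! i \<in> J}"
    have J'n: "J' \<subseteq> {..<?n}" by (auto simp: J'_def)
    have J': "indexed_subset vs J' = J" using J(1) unfolding J'_def V by (intro idx) auto
    have "feasible J'"
      unfolding feasible_def
    proof (intro conjI allI impI J'n)
      fix A assume A: "A \<subseteq> {..<?n} - J' \<and> A \<noteq> {}"
      then have card: "card (indexed_subset vs A) = card A" by (intro idx) auto
      have "indexed_subset vs A \<subseteq> V - J"
        using A by (auto simp: indexed_subset_def J'_def V)
      moreover have "indexed_subset vs A \<noteq> {}"
        using A by (auto simp: indexed_subset_def)
      ultimately show "real_of_int (?g A) \<le> \<rho> * real (card A)"
        using J(2) unfolding max_density_le_iff[OF finite_Diff[OF finV]] value_oracle_def card[symmetric]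
        by blast
    qed
    then show ?thesis
      using S(3)[of J'] S(1) J'n J' J(3) by (simp flip: idx(4))
  qed
  moreover have "?S \<subseteq> V" unfolding V by (rule idx)
  ultimately show "let t = ?t; R = returned_set density_deletion_com vs f c \<rho> \<epsilon> t in
          halts_within density_deletion_com vs f c \<rho> \<epsilon> t \<and>
          (\<forall>S\<in>set_pmf R. S \<subseteq> V \<and> max_density_le (V - S) f (c_param V f * (1 + \<epsilon>) * \<rho>)) \<and>
          measure_pmf.expectation R (\<lambda>S. \<Sum>u\<in>S. c u)
            \<le> c_param V f * (1 + 1 / \<epsilon>) * supmod_dd_opt V f c \<rho>"
    unfolding Let_def R halts_within_def run_instance_def run by simp
qed

end
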